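(* Let $(H_1,\|\cdot\|_{H_1})$ and $(H_2,\|\cdot\|_{H_2})$ be two separable Hilbert spaces, and fix any integer $n\ge 1$. There exists a Borel measurable map from $\mathcal{K}(H_1,H_2)$ to $H_1^n\times H_2^n$, $$A\mapsto (u_1^A,\dots,u_n^A,v_1^A,\dots,v_n^A),$$ such that, for every $A\in\mathcal{K}(H_1,H_2)$: (i) $Au_i^A=\sigma_i(A)v_i^A$ and $A^*v_i^A=\sigma_i(A)u_i^A$ for all $i=1,\dots,n$; (ii) the operator $A_n:=\sum_{i=1}^n\sigma_i(A)\langle\cdot,u_i^A\rangle_{H_1}v_i^A$ minimizes the $n$-rank truncation error, i.e. $$\|A-A_n\|_{op}=\inf\{\|A-L\|_{op}\;:\;L\in\mathcal{K}(H_1,H_2),\ \operatorname{rank}(L)\le n\};$$ (iii) for all $i,j\in\{1,\dots,n\}$ with $i,j\le\operatorname{rank}(A)$ one has $\langle u_i^A,u_j^A\rangle_{H_1}=\langle v_i^A,v_j^A\rangle_{H_2}=\delta_{i,j}$; (iv) the optimality in (ii) also holds with respect to the Hilbert-Schmidt norm, i.e. $\|A-A_n\|_{HS}=\inf\{\|A-L\|_{HS}:L\in\mathcal{K}(H_1,H_2),\ \operatorname{rank}(L)\le n\}$; (v) if $A=A^*$ (so that $H_1=H_2$), then $u_i^A=v_i^A$ for all $i=1,\dots,n$ with $\sigma_i(A)>0$.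
   Context: $\mathcal{K}(H_1,H_2)$ is the space of compact linear operators from $H_1$ to $H_2$, equipped with the operator norm $\|\cdot\|_{op}$ and the corresponding Borel $\sigma$-algebra; $H_1^n\times H_2^n$ carries its Borel $\sigma$-algebra for the norm topology. The rank of an operator is the dimension of its image. For $A\in\mathcal{K}(H_1,H_2)$ and $n\ge1$ the $n$-th singular value is $\sigma_n(A):=\inf\{\|A-L\|_{op}:L\in\mathcal{K}(H_1,H_2),\ \operatorname{rank}(L)\le n-1\}$. $A^*$ is the adjoint. The Hilbert-Schmidt norm is $\|A\|_{HS}:=\left(\sum_{i\ge1}\sigma_i(A)^2\right)^{1/2}$, with value $+\infty$ if the series diverges. Inner products are linear in the first argument, and $\langle\cdot,u\rangle v$ denotes the operator $x\mapsto\langle x,u\rangle v$.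
   Formalization: Clause (v) is false as printed (A = -id): for A = A* and σ_i(A) > 0 the formal statement gives u_i = v_i or u_i = -v_i, and u_i = v_i when A is moreover positive semidefinite. *)

theory Defs
  imports "HOL-Analysis.Analysis"
begin

text \<open>
  Scalars: the only real subalgebras of \<open>\<complex>\<close> are \<open>\<real>\<close> and \<open>\<complex>\<close> itself, so a type of this class is
  (a copy of) the real or the complex field, and both are instances. Conjugation is expressed
  through the embedding into the complex numbers.
\<close>

class real_or_complex = real_normed_field +
  fixes to_complex :: "'a \<Rightarrow> complex"
  assumes to_complex_add: "to_complex (x + y) = to_complex x + to_complex y"
    and to_complex_mult: "to_complex (x * y) = to_complex x * to_complex y"
    and to_complex_one: "to_complex 1 = 1"
    and to_complex_scaleR: "to_complex (r *\<^sub>R x) = r *\<^sub>R to_complex x"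
    and norm_to_complex: "norm (to_complex x) = norm x"

instantiation real :: real_or_complex
begin
definition to_complex_real :: "real \<Rightarrow> complex" where "to_complex_real = complex_of_real"
instance by standard (simp_all add: to_complex_real_def scaleR_conv_of_real)
end

instantiation complex :: real_or_complex
begin
definition to_complex_complex :: "complex \<Rightarrow> complex" where "to_complex_complex = id"
instance by standard (simp_all add: to_complex_complex_def)
end

text \<open>
  A separable Hilbert space over \<open>'k\<close>. Completeness and separability are in the sort of \<open>'a\<close>
  (for metric spaces, second countable and separable are the same); the real vector space
  structure of \<open>'a\<close> is the restriction of \<open>scale\<close> to real scalars, and its norm is the one
  induced by the inner product.
\<close>

locale hilbert_space = vector_space scale
  for scale :: "'k::real_or_complex \<Rightarrow> 'a::{banach,second_countable_topology} \<Rightarrow> 'a" +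
  fixes ip :: "'a \<Rightarrow> 'a \<Rightarrow> 'k"
  assumes scale_of_real: "scale (of_real r) x = r *\<^sub>R x"
    and ip_add_left: "ip (x + y) z = ip x z + ip y z"
    and ip_scale_left: "ip (scale c x) z = c * ip x z"
    and ip_cnj_commute: "to_complex (ip y x) = cnj (to_complex (ip x y))"
    and ip_self: "ip x x = of_real ((norm x)\<^sup>2)"

text \<open>
  Operators are elements of the normed space of bounded real-linear maps, whose norm is the
  operator norm; linearity over \<open>'k\<close> is required in addition (it is automatic if \<open>'k\<close> is \<open>\<real>\<close>).
\<close>

definition compact_ops ::
  "('k \<Rightarrow> 'a \<Rightarrow> 'a) \<Rightarrow> ('k \<Rightarrow> 'b \<Rightarrow> 'b) \<Rightarrow> ('a::real_normed_vector \<Rightarrow>\<^sub>L 'b::real_normed_vector) set"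
  where "compact_ops s1 s2 =
    {A. (\<forall>c x. blinfun_apply A (s1 c x) = s2 c (blinfun_apply A x)) \<and>
        compact (closure (blinfun_apply A ` cball 0 1))}"

text \<open>The case distinction is needed because \<^const>\<open>vector_space.dim\<close> is \<open>0\<close> in infinite dimension.\<close>

definition op_rank ::
  "('k::field \<Rightarrow> 'b \<Rightarrow> 'b) \<Rightarrow> ('a::real_normed_vector \<Rightarrow>\<^sub>L 'b::real_normed_vector) \<Rightarrow> enat"
  where "op_rank s2 A =
    (if \<exists>B. finite B \<and> range (blinfun_apply A) \<subseteq> module.span s2 B
     then enat (vector_space.dim s2 (range (blinfun_apply A))) else \<infinity>)"

definition sing_val ::
  "('k::field \<Rightarrow> 'a \<Rightarrow> 'a) \<Rightarrow> ('k \<Rightarrow> 'b \<Rightarrow> 'b) \<Rightarrow>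
   nat \<Rightarrow> ('a::real_normed_vector \<Rightarrow>\<^sub>L 'b::real_normed_vector) \<Rightarrow> real"
  where "sing_val s1 s2 i A =
    Inf {norm (A - L) | L. L \<in> compact_ops s1 s2 \<and> op_rank s2 L \<le> enat (i - 1)}"

definition hs_norm ::
  "('k::field \<Rightarrow> 'a \<Rightarrow> 'a) \<Rightarrow> ('k \<Rightarrow> 'b \<Rightarrow> 'b) \<Rightarrow>
   ('a::real_normed_vector \<Rightarrow>\<^sub>L 'b::real_normed_vector) \<Rightarrow> ereal"
  where "hs_norm s1 s2 A =
    (if summable (\<lambda>i. (sing_val s1 s2 (Suc i) A)\<^sup>2)
     then ereal (sqrt (\<Sum>i. (sing_val s1 s2 (Suc i) A)\<^sup>2)) else \<infinity>)"

definition adjoint_op ::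
  "('a \<Rightarrow> 'a \<Rightarrow> 'k) \<Rightarrow> ('b \<Rightarrow> 'b \<Rightarrow> 'k) \<Rightarrow>
   ('a::real_normed_vector \<Rightarrow>\<^sub>L 'b::real_normed_vector) \<Rightarrow> 'b \<Rightarrow> 'a"
  where "adjoint_op ip1 ip2 A = (THE B. \<forall>x y. ip2 (blinfun_apply A x) y = ip1 x (B y))"

definition rank_one_op ::
  "('a \<Rightarrow> 'a \<Rightarrow> 'k) \<Rightarrow> ('k \<Rightarrow> 'b \<Rightarrow> 'b) \<Rightarrow>
   'a \<Rightarrow> 'b \<Rightarrow> ('a::real_normed_vector \<Rightarrow>\<^sub>L 'b::real_normed_vector)"
  where "rank_one_op ip1 s2 u v = Blinfun (\<lambda>x. s2 (ip1 x u) v)"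

definition truncation ::
  "('k::field \<Rightarrow> 'a \<Rightarrow> 'a) \<Rightarrow> ('a \<Rightarrow> 'a \<Rightarrow> 'k) \<Rightarrow> ('k \<Rightarrow> 'b \<Rightarrow> 'b) \<Rightarrow> nat \<Rightarrow>
   ('a::real_normed_vector \<Rightarrow>\<^sub>L 'b::real_normed_vector) \<Rightarrow> (nat \<Rightarrow> 'a) \<Rightarrow> (nat \<Rightarrow> 'b) \<Rightarrow> ('a \<Rightarrow>\<^sub>L 'b)"
  where "truncation s1 ip1 s2 n A u v =
    (\<Sum>i = 1..n. sing_val s1 s2 i A *\<^sub>R rank_one_op ip1 s2 (u i) (v i))"

definition truncated_svd ::
  "('k::field \<Rightarrow> 'a \<Rightarrow> 'a) \<Rightarrow> ('a \<Rightarrow> 'a \<Rightarrow> 'k) \<Rightarrow>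
   ('k \<Rightarrow> 'b \<Rightarrow> 'b) \<Rightarrow> ('b \<Rightarrow> 'b \<Rightarrow> 'k) \<Rightarrow> nat \<Rightarrow>
   ('a::real_normed_vector \<Rightarrow>\<^sub>L 'b::real_normed_vector) \<Rightarrow> (nat \<Rightarrow> 'a) \<Rightarrow> (nat \<Rightarrow> 'b) \<Rightarrow> bool"
  where "truncated_svd s1 ip1 s2 ip2 n A u v \<longleftrightarrow>
    (\<forall>i\<in>{1..n}. blinfun_apply A (u i) = sing_val s1 s2 i A *\<^sub>R v i \<and>
                adjoint_op ip1 ip2 A (v i) = sing_val s1 s2 i A *\<^sub>R u i) \<and>
    norm (A - truncation s1 ip1 s2 n A u v) =
      Inf {norm (A - L) | L. L \<in> compact_ops s1 s2 \<and> op_rank s2 L \<le> enat n} \<and>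
    (\<forall>i\<in>{1..n}. \<forall>j\<in>{1..n}. enat i \<le> op_rank s2 A \<and> enat j \<le> op_rank s2 A \<longrightarrow>
                ip1 (u i) (u j) = (if i = j then 1 else 0) \<and>
                ip2 (v i) (v j) = (if i = j then 1 else 0)) \<and>
    hs_norm s1 s2 (A - truncation s1 ip1 s2 n A u v) =
      Inf {hs_norm s1 s2 (A - L) | L. L \<in> compact_ops s1 s2 \<and> op_rank s2 L \<le> enat n}"

definition self_adjoint_op ::
  "('a \<Rightarrow> 'a \<Rightarrow> 'k) \<Rightarrow> ('a::real_normed_vector \<Rightarrow>\<^sub>L 'a) \<Rightarrow> bool"
  where "self_adjoint_op ip A \<longleftrightarrow> blinfun_apply A = adjoint_op ip ip A"

text \<open>
  A self-adjoint operator has \<open>A u = \<sigma> v\<close>, \<open>A v = \<sigma> u\<close> with \<open>u = v\<close> only at nonnegative eigenvalues: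
  for \<open>A = - id\<close> on a nonzero space, unit singular vectors satisfy \<open>v = - u\<close>. Hence left and right
  singular vectors can be matched exactly for positive operators, and up to sign in general.
\<close>

definition positive_op ::
  "('a \<Rightarrow> 'a \<Rightarrow> 'k::real_or_complex) \<Rightarrow> ('a::real_normed_vector \<Rightarrow>\<^sub>L 'a) \<Rightarrow> bool"
  where "positive_op ip A \<longleftrightarrow>
    self_adjoint_op ip A \<and> (\<forall>x. 0 \<le> Re (to_complex (ip (blinfun_apply A x) x)))"

definition borel_of :: "'a topology \<Rightarrow> 'a measure"
  where "borel_of X = sigma (topspace X) {U. openin X U}"

text \<open>
  The norm topology of the \<open>n\<close>-fold powers is the product topology; an element of the power is a
  function on \<open>{1..n}\<close> (extended by \<^const>\<open>undefined\<close>).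
\<close>

definition frames_topology ::
  "nat \<Rightarrow> ((nat \<Rightarrow> 'a::topological_space) \<times> (nat \<Rightarrow> 'b::topological_space)) topology"
  where "frames_topology n =
    prod_topology (product_topology (\<lambda>_. euclidean) {1..n}) (product_topology (\<lambda>_. euclidean) {1..n})"

end

theory Submission
  imports Defs
begin

text \<open>
  The map is obtained by deflation: pick a unit vector \<open>u\<close> with \<open>A\<^sup>* A u = \<parallel>A\<parallel>\<^sup>2 u\<close>, put
  \<open>v = A u / \<parallel>A\<parallel>\<close>, replace \<open>A\<close> by \<open>A - \<parallel>A\<parallel> \<langle>\<cdot>, u\<rangle> v\<close> and repeat. The \<open>k\<close>-th remainder has norm
  \<open>\<sigma>\<^bsub>k+1\<^esub>(A)\<close>, and its own singular values are those of \<open>A\<close> shifted by \<open>k\<close>, which yields optimality in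
  both norms. Measurability reduces to that of one choice of \<open>u\<close>: the powers of \<open>A\<^sup>* A / \<parallel>A\<parallel>\<^sup>2\<close> converge
  pointwise to the projection \<open>P\<close> onto its fixed space, and \<open>u\<close> is \<open>P d\<close> normalized, for the first
  \<open>d\<close> in a dense sequence with \<open>P d \<noteq> 0\<close>. For self-adjoint \<open>A\<close> this \<open>u\<close> is then corrected to be
  an eigenvector of \<open>A\<close> itself.
\<close>

section \<open>Hilbert spaces\<close>

lemma to_complex_of_real: "to_complex (of_real r :: 'k::real_or_complex) = of_real r"
  by (simp add: of_real_def to_complex_scaleR to_complex_one)

lemma linear_to_complex: "linear (to_complex :: 'k::real_or_complex \<Rightarrow> complex)"
  by (rule linearI) (simp_all add: to_complex_add to_complex_scaleR)

lemmas to_complex_0 = linear_0[OF linear_to_complex]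
  and to_complex_diff = linear_diff[OF linear_to_complex]

lemma to_complex_inject: "to_complex x = to_complex y \<longleftrightarrow> x = (y :: 'k::real_or_complex)"
  by (metis eq_iff_diff_eq_0 norm_eq_zero norm_to_complex to_complex_diff)

lemma bounded_linear_Re_to_complex:
  "bounded_linear (\<lambda>x :: 'k::real_or_complex. Re (to_complex x))"
  by (rule bounded_linear_intro[of _ 1])
     (simp_all add: to_complex_add to_complex_scaleR,
      metis abs_Re_le_cmod norm_to_complex)

text \<open>The range of \<open>to_complex\<close> is a real subspace of the complex plane, hence
  closed, and the inverse embedding is an isometry on it. Compactness of rank-one operators rests on
  this.\<close>

lemma compact_cball_real_or_complex: "compact (cball 0 r :: 'k::real_or_complex set)"
proof -
  define R where "R = range (to_complex :: 'k \<Rightarrow> complex)"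
  define g where "g = (inv to_complex :: complex \<Rightarrow> 'k)"
  have inj: "inj (to_complex :: 'k \<Rightarrow> complex)"
    by (simp add: inj_on_def to_complex_inject)
  have "closed R"
    unfolding R_def by (intro closed_subspace linear_subspace_image linear_to_complex subspace_UNIV)
  then have K: "compact (cball 0 r \<inter> R)"
    by (simp add: compact_Int_closed)
  have "dist (g x) (g y) = dist x y" if xy: "x \<in> R" "y \<in> R" for x y
  proof -
    obtain x' y' :: 'k where "x = to_complex x'" "y = to_complex y'" using xy by (auto simp: R_def)
    then show ?thesis
      by (simp add: g_def inv_f_f[OF inj] dist_norm norm_to_complex flip: to_complex_diff)
  qed
  then have "continuous_on (cball 0 r \<inter> R) g"
    by (intro continuous_onI) auto
  moreover have "cball 0 r = g ` (cball 0 r \<inter> R)"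
    by (force simp: g_def R_def inv_f_f[OF inj] norm_to_complex image_iff)
  ultimately show ?thesis
    using K compact_continuous_image by metis
qed

context hilbert_space
begin

lemma ip_scaleR_left: "ip (r *\<^sub>R x) y = r *\<^sub>R ip x y"
  by (metis ip_scale_left scaleR_conv_of_real scale_of_real)

lemma ip_add_right: "ip x (y + z) = ip x y + ip x z"
  by (metis complex_cnj_add ip_add_left ip_cnj_commute to_complex_add to_complex_inject)

lemma ip_scaleR_right: "ip x (r *\<^sub>R y) = r *\<^sub>R ip x y"
  by (metis complex_cnj_scaleR ip_cnj_commute ip_scaleR_left to_complex_inject to_complex_scaleR)

lemma to_complex_ip_self: "to_complex (ip x x) = of_real ((norm x)\<^sup>2)"
  by (simp add: ip_self to_complex_of_real del: of_real_power)

text \<open>The sort of \<open>'a\<close> gives homogeneity for real factors only; for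
  \<open>'k\<close> it is read off from the inner product.\<close>

lemma norm_scale: "norm (scale c x) = norm c * norm x"
proof -
  have "to_complex (ip (scale c x) (scale c x)) =
      to_complex c * cnj (to_complex c * to_complex (ip x x))"
    by (metis ip_cnj_commute ip_scale_left to_complex_mult)
  also have "\<dots> = (to_complex c * cnj (to_complex c)) * of_real ((norm x)\<^sup>2)"
    by (simp add: to_complex_ip_self)
  also have "\<dots> = of_real ((norm c)\<^sup>2 * (norm x)\<^sup>2)"
    by (simp add: norm_to_complex flip: complex_norm_square)
  finally have "complex_of_real ((norm (scale c x))\<^sup>2) = of_real ((norm c * norm x)\<^sup>2)"
    by (simp only: to_complex_ip_self power_mult_distrib)
  then have "(norm (scale c x))\<^sup>2 = (norm c * norm x)\<^sup>2"
    by (simp only: of_real_eq_iff)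
  then show ?thesis
    by simp
qed

lemma scaleR_scale: "r *\<^sub>R scale c x = scale (r *\<^sub>R c) x"
  by (simp add: scaleR_conv_of_real flip: scale_of_real)

lemma scale_scaleR: "scale c (r *\<^sub>R x) = r *\<^sub>R scale c x"
  by (simp only: mult.commute scale_scale flip: scale_of_real)

lemma bounded_bilinear_scale: "bounded_bilinear scale"
  by unfold_locales
     (auto simp: scale_left_distrib scale_right_distrib scaleR_scale scale_scaleR norm_scale intro: exI[of _ 1])

text \<open>The inner product of the underlying real space, in which squares of norms are
  expanded.\<close>

definition rip where "rip x y = Re (to_complex (ip x y))"

lemma rip_add_left: "rip (x + y) z = rip x z + rip y z"
  and rip_add_right: "rip x (y + z) = rip x y + rip x z"
  and rip_scaleR_left: "rip (r *\<^sub>R x) y = r * rip x y"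
  and rip_scaleR_right: "rip x (r *\<^sub>R y) = r * rip x y"
  by (simp_all add: rip_def ip_add_left ip_add_right to_complex_add ip_scaleR_left ip_scaleR_right
      to_complex_scaleR)

lemma rip_commute: "rip x y = rip y x"
  by (metis cnj.simps(1) ip_cnj_commute rip_def)

lemma rip_self: "rip x x = (norm x)\<^sup>2"
  by (simp add: rip_def to_complex_ip_self)

lemma rip_minus_left: "rip (- x) y = - rip x y"
  using rip_scaleR_left[of "-1" x y] by simp

lemma rip_minus_right: "rip x (- y) = - rip x y"
  using rip_scaleR_right[of x "-1" y] by simp

lemma rip_diff_left: "rip (x - y) z = rip x z - rip y z"
  using rip_add_left[of x "- y" z] by (simp add: rip_minus_left)

lemma rip_diff_right: "rip x (y - z) = rip x y - rip x z"
  using rip_add_right[of x y "- z"] by (simp add: rip_minus_right)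

lemmas rip_simps = rip_add_left rip_add_right rip_scaleR_left rip_scaleR_right
  rip_diff_left rip_diff_right

lemma norm_add_sq: "(norm (x + y))\<^sup>2 = (norm x)\<^sup>2 + 2 * rip x y + (norm y)\<^sup>2"
  by (simp add: rip_simps rip_commute[of y x] flip: rip_self)

lemma norm_diff_sq: "(norm (x - y))\<^sup>2 = (norm x)\<^sup>2 - 2 * rip x y + (norm y)\<^sup>2"
  by (simp add: rip_simps rip_commute[of y x] flip: rip_self)

text \<open>Cauchy-Schwarz, from the nonnegative square of
  \<open>norm y *\<^sub>R x - norm x *\<^sub>R y\<close>.\<close>

lemma rip_le: "rip x y \<le> norm x * norm y"
proof (cases "x = 0 \<or> y = 0")
  case True
  then show ?thesis
    using rip_scaleR_left[of 0 x y] rip_scaleR_right[of x 0 y] by auto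
next
  case False
  have "0 \<le> (norm (norm y *\<^sub>R x - norm x *\<^sub>R y))\<^sup>2" by simp
  also have "\<dots> = 2 * (norm x * norm y) * (norm x * norm y - rip x y)"
    by (simp add: norm_diff_sq rip_simps) (simp add: algebra_simps power2_eq_square)
  finally show ?thesis
    using False by (auto simp: zero_le_mult_iff mult_le_0_iff)
qed

text \<open>Multiplying \<open>x\<close> by the scalar \<open>ip y x\<close> makes its inner product
  with \<open>y\<close> real and nonnegative, so that the real inequality applies.\<close>

lemma norm_ip_le: "norm (ip x y) \<le> norm x * norm y"
proof -
  have "to_complex (ip (scale (ip y x) x) y) = cnj (to_complex (ip x y)) * to_complex (ip x y)"
    by (metis ip_cnj_commute ip_scale_left to_complex_mult)
  also have "\<dots> = of_real ((norm (ip x y))\<^sup>2)"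
    by (metis complex_norm_square mult.commute norm_to_complex of_real_power)
  finally have "to_complex (ip (scale (ip y x) x) y) = of_real ((norm (ip x y))\<^sup>2)" .
  then have "(norm (ip x y))\<^sup>2 = rip (scale (ip y x) x) y"
    by (simp add: rip_def del: of_real_power)
  also have "\<dots> \<le> norm (ip y x) * norm x * norm y"
    using rip_le[of "scale (ip y x) x" y] by (simp add: norm_scale)
  also have "norm (ip y x) = norm (ip x y)"
    by (metis complex_mod_cnj ip_cnj_commute norm_to_complex)
  finally show ?thesis
    by (cases "ip x y = 0") (simp_all add: power2_eq_square mult.assoc)
qed

lemma bounded_bilinear_ip: "bounded_bilinear ip"
  by unfold_locales
     (auto simp: ip_add_left ip_add_right ip_scaleR_left ip_scaleR_right norm_ip_le intro: exI[of _ 1])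

lemma bounded_linear_rip_left: "bounded_linear (\<lambda>x. rip x y)"
  unfolding rip_def
  by (rule bounded_linear_compose[OF bounded_linear_Re_to_complex
        bounded_bilinear.bounded_linear_left[OF bounded_bilinear_ip]])

lemmas ip_0_left [simp] = bounded_bilinear.zero_left[OF bounded_bilinear_ip]
  and ip_0_right [simp] = bounded_bilinear.zero_right[OF bounded_bilinear_ip]
  and ip_diff_left = bounded_bilinear.diff_left[OF bounded_bilinear_ip]
  and ip_diff_right = bounded_bilinear.diff_right[OF bounded_bilinear_ip]
  and ip_sum_left = bounded_bilinear.sum_left[OF bounded_bilinear_ip]

lemma ip_eq_0_commute: "ip x y = 0 \<longleftrightarrow> ip y x = 0"
  by (metis complex_cnj_zero_iff ip_cnj_commute to_complex_0 to_complex_inject)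

lemma ip_unit: "norm x = 1 \<Longrightarrow> ip x x = 1"
  by (simp add: ip_self)

lemma ip_right_inject: "(\<And>x. ip x y = ip x z) \<Longrightarrow> y = z"
proof -
  assume *: "\<And>x. ip x y = ip x z"
  then have "ip (y - z) (y - z) = 0"
    by (simp add: ip_diff_right)
  then show "y = z"
    by (simp add: ip_self)
qed

text \<open>The representing vector is the minimizer of \<open>\<phi>\<close>: minimizing sequences
  are Cauchy by the parallelogram law, and stationarity at the minimum is the claimed
  identity.\<close>

lemma riesz_real:
  assumes "bounded_linear g"
  shows "\<exists>y. \<forall>x. g x = rip x y"
proof -
  interpret g: bounded_linear g by fact
  obtain K where K: "\<And>x. norm (g x) \<le> norm x * K" using g.bounded by blast
  define \<phi> where "\<phi> x = (norm x)\<^sup>2 - 2 * g x" for x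
  define m where "m = Inf (range \<phi>)"
  have "- K\<^sup>2 \<le> \<phi> x" for x
  proof -
    have "0 \<le> (norm x - K)\<^sup>2" by simp
    then show ?thesis
      using K[of x] by (simp add: \<phi>_def power2_eq_square algebra_simps abs_le_iff)
  qed
  then have bdd: "bdd_below (range \<phi>)" by (auto simp: bdd_below_def)
  then have m_le: "m \<le> \<phi> x" for x
    by (auto simp: m_def intro: cInf_lower)
  have "\<exists>x. \<phi> x < m + inverse (Suc k)" for k
    using cInf_lessD[of "range \<phi>" "m + inverse (Suc k)"] by (auto simp: m_def)
  then obtain X where X: "\<And>k. \<phi> (X k) < m + inverse (Suc k)" by metis
  have par: "(norm (x - y))\<^sup>2 = 2 * \<phi> x + 2 * \<phi> y - 4 * \<phi> ((1/2) *\<^sub>R (x + y))" for x y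
  proof -
    have "(norm ((1/2) *\<^sub>R (x + y)))\<^sup>2 = (norm (x + y))\<^sup>2 / 4"
      by (simp add: power_divide)
    then show ?thesis
      by (simp add: \<phi>_def g.scaleR g.add norm_add_sq norm_diff_sq algebra_simps)
  qed
  have diff_sq: "(norm (X i - X j))\<^sup>2 < 4 * inverse (Suc k)" if "k \<le> i" "k \<le> j" for i j k
  proof -
    have "inverse (real (Suc i)) \<le> inverse (Suc k)" "inverse (real (Suc j)) \<le> inverse (Suc k)"
      using that by (auto intro: le_imp_inverse_le)
    then show ?thesis
      using par[of "X i" "X j"] X[of i] X[of j] m_le[of "(1/2) *\<^sub>R (X i + X j)"] by argo
  qed
  have "Cauchy X"
  proof (rule metric_CauchyI)
    fix e :: real assume "e > 0"
    then obtain k where "inverse (Suc k) < e\<^sup>2 / 4"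
      using reals_Archimedean[of "e\<^sup>2 / 4"] by auto
    then have "(norm (X i - X j))\<^sup>2 < e\<^sup>2" if "k \<le> i" "k \<le> j" for i j
      using diff_sq[OF that] by linarith
    then show "\<exists>M. \<forall>m\<ge>M. \<forall>n\<ge>M. dist (X m) (X n) < e"
      using \<open>e > 0\<close> by (auto simp: dist_norm intro!: exI[of _ k] power2_less_imp_less[of _ e])
  qed
  then obtain y where y: "X \<longlonglongrightarrow> y"
    by (auto simp: Cauchy_convergent_iff convergent_def)
  have "(\<lambda>k. \<phi> (X k)) \<longlonglongrightarrow> \<phi> y"
    unfolding \<phi>_def by (intro tendsto_intros y g.tendsto)
  moreover have "(\<lambda>k. m + inverse (Suc k)) \<longlonglongrightarrow> m + 0"
    by (intro tendsto_intros LIMSEQ_inverse_real_of_nat)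
  ultimately have "\<phi> y \<le> m"
    using X by (intro LIMSEQ_le[of "\<lambda>k. \<phi> (X k)" "\<phi> y"]) (auto intro: less_imp_le)
  have "g x = rip x y" for x
  proof (rule ccontr)
    assume neq: "g x \<noteq> rip x y"
    then have "x \<noteq> 0"
      using rip_scaleR_left[of 0 x y] by (auto simp: g.zero)
    define d where "d = g x - rip x y"
    \<comment> \<open>The value at which t^2 |x|^2 - 2 t d, the change of \<open>\<phi>\<close> from
      \<open>y\<close> in direction \<open>x\<close>, is smallest.\<close>
    define t where "t = d / (norm x)\<^sup>2"
    have "\<phi> (y + t *\<^sub>R x) = \<phi> y + (t\<^sup>2 * (norm x)\<^sup>2 - 2 * t * d)"
      by (simp add: \<phi>_def norm_add_sq g.add g.scaleR rip_simps d_def rip_commute[of y x]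
          power_mult_distrib algebra_simps)
    also have "t\<^sup>2 * (norm x)\<^sup>2 - 2 * t * d = - (d\<^sup>2 / (norm x)\<^sup>2)"
      using \<open>x \<noteq> 0\<close> by (simp add: t_def field_simps power2_eq_square)
    also have "\<phi> y + \<dots> < \<phi> y"
      using neq \<open>x \<noteq> 0\<close> by (simp add: d_def)
    finally show False
      using m_le[of "y + t *\<^sub>R x"] \<open>\<phi> y \<le> m\<close> by simp
  qed
  then show ?thesis by blast
qed

lemma riesz:
  assumes "bounded_linear f" and scale: "\<And>c x. f (scale c x) = c * f x"
  shows "\<exists>y. \<forall>x. f x = ip x y"
proof -
  obtain y where y: "\<And>x. Re (to_complex (f x)) = rip x y"
    using riesz_real[OF bounded_linear_compose[OF bounded_linear_Re_to_complex assms(1)]] by blast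
  have "f x = ip x y" for x
  proof -
    define d where "d = f x - ip x y"
    have "Re (to_complex (c * d)) = 0" for c
      using y[of "scale c x"]
      by (simp add: d_def rip_def scale ip_scale_left right_diff_distrib to_complex_diff)
    \<comment> \<open>The factor \<open>d\<close> gives (Re d)^2 - (Im d)^2 = 0. This treats real
      and complex scalars alike, without an imaginary unit in \<open>'k\<close>.\<close>
    from this[of 1] this[of d] have "Re (to_complex d) = 0" "Im (to_complex d) = 0"
      by (simp_all add: to_complex_mult)
    then have "d = 0"
      by (metis complex_eq_iff to_complex_0 to_complex_inject zero_complex.simps)
    then show ?thesis
      by (simp add: d_def)
  qed
  then show ?thesis by blast
qed

end

section \<open>Adjoints, compact operators and rank\<close>

locale hilbert_pair =
  H1: hilbert_space s1 ip1 + H2: hilbert_space s2 ip2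
  for s1 :: "'k::real_or_complex \<Rightarrow> 'a::{banach,second_countable_topology} \<Rightarrow> 'a"
    and ip1 :: "'a \<Rightarrow> 'a \<Rightarrow> 'k"
    and s2 :: "'k \<Rightarrow> 'b::{banach,second_countable_topology} \<Rightarrow> 'b"
    and ip2 :: "'b \<Rightarrow> 'b \<Rightarrow> 'k"
begin

definition linear_op :: "('a \<Rightarrow>\<^sub>L 'b) \<Rightarrow> bool"
  where "linear_op A \<longleftrightarrow> (\<forall>c x. A (s1 c x) = s2 c (A x))"

text \<open>A bounded operator made of the bare function \<open>adjoint_op\<close>; the two agree on
  operators that are linear over \<open>'k\<close>.\<close>

definition adj :: "('a \<Rightarrow>\<^sub>L 'b) \<Rightarrow> ('b \<Rightarrow>\<^sub>L 'a)"
  where "adj A = Blinfun (adjoint_op ip1 ip2 A)"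

lemma linear_opD: "linear_op A \<Longrightarrow> A (s1 c x) = s2 c (A x)"
  by (simp add: linear_op_def)

lemma adjoint_op_eqI:
  assumes "\<And>x y. ip2 (blinfun_apply A x) y = ip1 x (B y)"
  shows "adjoint_op ip1 ip2 A = B"
  unfolding adjoint_op_def
  by (rule the_equality) (use assms in \<open>auto intro!: H1.ip_right_inject\<close>)

text \<open>Riesz representation of the functionals \<open>\<lambda>x. ip2 (A x) y\<close> supplies
  a function with the defining property of the description.\<close>

lemma ip_adjoint_op:
  assumes "linear_op A"
  shows "ip2 (A x) y = ip1 x (adjoint_op ip1 ip2 A y)"
proof -
  have "\<exists>z. \<forall>x. ip2 (A x) y = ip1 x z" for y
    by (intro H1.riesz bounded_linear_compose[OF
          bounded_bilinear.bounded_linear_left[OF H2.bounded_bilinear_ip] blinfun.bounded_linear_right])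
       (simp add: linear_opD[OF assms] H2.ip_scale_left)
  then obtain B where "\<And>x y. ip2 (A x) y = ip1 x (B y)"
    by metis
  with adjoint_op_eqI[of A B] show ?thesis by simp
qed

lemma norm_adjoint_op_le:
  assumes "linear_op A"
  shows "norm (adjoint_op ip1 ip2 A y) \<le> norm A * norm y"
proof -
  let ?z = "adjoint_op ip1 ip2 A y"
  have "(norm ?z)\<^sup>2 = H2.rip (A ?z) y"
    by (simp add: H2.rip_def ip_adjoint_op[OF assms] flip: H1.rip_self H1.rip_def)
  also have "\<dots> \<le> norm (A ?z) * norm y" by (rule H2.rip_le)
  also have "\<dots> \<le> norm A * norm ?z * norm y"
    by (intro mult_right_mono norm_blinfun) simp
  finally show ?thesis
    by (cases "?z = 0") (simp_all add: power2_eq_square mult.assoc)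
qed

lemma bounded_linear_adjoint_op:
  assumes "linear_op A"
  shows "bounded_linear (adjoint_op ip1 ip2 A)"
proof (rule bounded_linear_intro)
  fix y z r
  show "adjoint_op ip1 ip2 A (y + z) = adjoint_op ip1 ip2 A y + adjoint_op ip1 ip2 A z"
    by (rule H1.ip_right_inject) (simp add: H1.ip_add_right H2.ip_add_right flip: ip_adjoint_op[OF assms])
  show "adjoint_op ip1 ip2 A (r *\<^sub>R y) = r *\<^sub>R adjoint_op ip1 ip2 A y"
    by (rule H1.ip_right_inject) (simp add: H1.ip_scaleR_right H2.ip_scaleR_right flip: ip_adjoint_op[OF assms])
  show "norm (adjoint_op ip1 ip2 A y) \<le> norm y * norm A"
    using norm_adjoint_op_le[OF assms] by (simp add: mult.commute)
qed

lemma adj_apply: "linear_op A \<Longrightarrow> blinfun_apply (adj A) = adjoint_op ip1 ip2 A"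
  by (simp add: adj_def bounded_linear_Blinfun_apply bounded_linear_adjoint_op)

lemma ip_adj: "linear_op A \<Longrightarrow> ip2 (A x) y = ip1 x (adj A y)"
  by (simp add: adj_apply ip_adjoint_op)

lemma rip_adj: "linear_op A \<Longrightarrow> H2.rip (A x) y = H1.rip x (adj A y)"
  by (simp add: H1.rip_def H2.rip_def ip_adj)

lemma norm_adj_apply_le: "linear_op A \<Longrightarrow> norm (adj A y) \<le> norm A * norm y"
  by (simp add: adj_apply norm_adjoint_op_le)

lemma adj_eqI:
  assumes "\<And>x y. ip2 (blinfun_apply A x) y = ip1 x (blinfun_apply B y)"
  shows "adj A = B"
  using adjoint_op_eqI[of A "blinfun_apply B"] assms
  by (simp add: adj_def blinfun_apply_inverse)

lemma linear_op_0: "linear_op 0"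
  by (simp add: linear_op_def)

lemma linear_op_add: "linear_op A \<Longrightarrow> linear_op B \<Longrightarrow> linear_op (A + B)"
  by (simp add: linear_op_def blinfun.add_left H2.scale_right_distrib)

lemma linear_op_scaleR: "linear_op A \<Longrightarrow> linear_op (r *\<^sub>R A)"
  by (simp add: linear_op_def blinfun.scaleR_left H2.scale_scaleR)

lemma linear_op_diff: "linear_op A \<Longrightarrow> linear_op B \<Longrightarrow> linear_op (A - B)"
  using linear_op_add[OF _ linear_op_scaleR, of A B "-1"] by simp

lemma adj_diff: "linear_op A \<Longrightarrow> linear_op B \<Longrightarrow> adj (A - B) = adj A - adj B"
  by (rule adj_eqI) (simp add: blinfun.diff_left H1.ip_diff_right H2.ip_diff_left ip_adj)

lemma adj_scaleR: "linear_op A \<Longrightarrow> adj (r *\<^sub>R A) = r *\<^sub>R adj A"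
  by (rule adj_eqI) (simp add: blinfun.scaleR_left H1.ip_scaleR_right H2.ip_scaleR_left ip_adj)

abbreviation rank_one :: "'a \<Rightarrow> 'b \<Rightarrow> ('a \<Rightarrow>\<^sub>L 'b)"
  where "rank_one \<equiv> rank_one_op ip1 s2"

lemma bounded_linear_rank_one: "bounded_linear (\<lambda>x. s2 (ip1 x u) v)"
  by (intro bounded_linear_compose[OF bounded_bilinear.bounded_linear_left[OF H2.bounded_bilinear_scale]]
      bounded_bilinear.bounded_linear_left[OF H1.bounded_bilinear_ip])

lemma rank_one_apply: "rank_one u v x = s2 (ip1 x u) v"
  by (simp add: rank_one_op_def bounded_linear_Blinfun_apply bounded_linear_rank_one)

lemma linear_op_rank_one: "linear_op (rank_one u v)"
  by (simp add: linear_op_def rank_one_apply H1.ip_scale_left)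

section \<open>Compact operators\<close>

lemma compact_ops_linear: "A \<in> compact_ops s1 s2 \<Longrightarrow> linear_op A"
  by (simp add: compact_ops_def linear_op_def)

text \<open>Lying in some compact set passes to sums and multiples more easily than compactness of
  the closure does.\<close>

lemma compact_opsI:
  assumes "linear_op A" and "compact K" and "A ` cball 0 1 \<subseteq> K"
  shows "A \<in> compact_ops s1 s2"
proof -
  have "closure (A ` cball 0 1) \<subseteq> K"
    using assms by (intro closure_minimal compact_imp_closed)
  then have "compact (closure (A ` cball 0 1))"
    using compact_Int_closed[OF \<open>compact K\<close>, of "closure (A ` cball 0 1)"] by (simp add: Int_absorb1)
  with assms(1) show ?thesis
    by (simp add: compact_ops_def linear_op_def)
qed

lemma compact_ops_D:
  assumes "A \<in> compact_ops s1 s2"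
  obtains K where "compact K" "A ` cball 0 1 \<subseteq> K"
  using assms closure_subset[of "A ` cball 0 1"] by (auto simp: compact_ops_def)

lemma compact_ops_0: "0 \<in> compact_ops s1 s2"
  by (rule compact_opsI[of _ "{0}"]) (auto simp: linear_op_0)

lemma compact_ops_add:
  assumes "A \<in> compact_ops s1 s2" "B \<in> compact_ops s1 s2"
  shows "A + B \<in> compact_ops s1 s2"
proof -
  obtain K L where KL: "compact K" "A ` cball 0 1 \<subseteq> K" "compact L" "B ` cball 0 1 \<subseteq> L"
    using assms by (meson compact_ops_D)
  show ?thesis
    by (rule compact_opsI[OF _ compact_sums[OF KL(1,3)]])
       (use KL assms in \<open>auto simp: blinfun.add_left linear_op_add compact_ops_linear image_subset_iff\<close>)
qed

lemma compact_ops_scaleR: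
  assumes "A \<in> compact_ops s1 s2"
  shows "r *\<^sub>R A \<in> compact_ops s1 s2"
proof -
  obtain K where K: "compact K" "A ` cball 0 1 \<subseteq> K"
    using assms by (meson compact_ops_D)
  show ?thesis
    by (rule compact_opsI[OF _ compact_scaling[OF K(1), of r]])
       (use K assms in \<open>auto simp: blinfun.scaleR_left linear_op_scaleR compact_ops_linear\<close>)
qed

lemma compact_ops_diff:
  "A \<in> compact_ops s1 s2 \<Longrightarrow> B \<in> compact_ops s1 s2 \<Longrightarrow> A - B \<in> compact_ops s1 s2"
  using compact_ops_add[OF _ compact_ops_scaleR, of A B "-1"] by simp

lemma compact_ops_rank_one: "rank_one u v \<in> compact_ops s1 s2"
proof (rule compact_opsI[OF linear_op_rank_one])
  show "compact ((\<lambda>c. s2 c v) ` cball 0 (norm u))"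
    by (intro compact_continuous_image linear_continuous_on compact_cball_real_or_complex
        bounded_bilinear.bounded_linear_left[OF H2.bounded_bilinear_scale])
  have "norm (ip1 x u) \<le> norm u" if "norm x \<le> 1" for x
    using H1.norm_ip_le[of x u] mult_right_mono[OF that, of "norm u"] by simp
  then show "rank_one u v ` cball 0 1 \<subseteq> (\<lambda>c. s2 c v) ` cball 0 (norm u)"
    by (auto simp: rank_one_apply)
qed

lemma compact_ops_sum: "(\<And>i. i \<in> I \<Longrightarrow> f i \<in> compact_ops s1 s2) \<Longrightarrow> sum f I \<in> compact_ops s1 s2"
  by (induction I rule: infinite_finite_induct) (auto simp: compact_ops_0 compact_ops_add)

section \<open>Operators of finite rank\<close>

text \<open>In this form the case distinction of \<open>op_rank\<close> disappears, and
  subadditivity of the rank is a union of spanning sets.\<close>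

lemma op_rank_le_iff:
  "op_rank s2 A \<le> enat k \<longleftrightarrow> (\<exists>B. finite B \<and> card B \<le> k \<and> range A \<subseteq> H2.span B)"
proof
  assume le: "op_rank s2 A \<le> enat k"
  then obtain C where C: "finite C" "range A \<subseteq> H2.span C"
    by (auto simp: op_rank_def split: if_splits)
  with le have dim: "H2.dim (range A) \<le> k"
    by (auto simp: op_rank_def split: if_splits)
  obtain B where B: "B \<subseteq> range A" "H2.independent B" "range A \<subseteq> H2.span B" "card B = H2.dim (range A)"
    by (rule H2.basis_exists)
  with C have "finite B"
    using H2.independent_span_bound[of C B] by blast
  with B dim show "\<exists>B. finite B \<and> card B \<le> k \<and> range A \<subseteq> H2.span B" by auto
next
  assume "\<exists>B. finite B \<and> card B \<le> k \<and> range A \<subseteq> H2.span B"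
  then obtain B where "finite B" "card B \<le> k" "range A \<subseteq> H2.span B" by blast
  then show "op_rank s2 A \<le> enat k"
    using H2.dim_le_card[of "range A" B] by (auto simp: op_rank_def)
qed

lemma op_rank_0: "op_rank s2 (0 :: 'a \<Rightarrow>\<^sub>L 'b) \<le> enat k"
  unfolding op_rank_le_iff by (intro exI[of _ "{}"]) auto

lemma op_rank_rank_one: "op_rank s2 (rank_one u v) \<le> enat 1"
  unfolding op_rank_le_iff
  by (intro exI[of _ "{v}"]) (auto simp: rank_one_apply intro: H2.span_scale H2.span_base)

lemma op_rank_add:
  assumes "op_rank s2 A \<le> enat k" "op_rank s2 B \<le> enat l"
  shows "op_rank s2 (A + B) \<le> enat (k + l)"
proof -
  obtain C D where CD: "finite C" "card C \<le> k" "range A \<subseteq> H2.span C"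
      "finite D" "card D \<le> l" "range B \<subseteq> H2.span D"
    using assms unfolding op_rank_le_iff by metis
  have "A x + B x \<in> H2.span (C \<union> D)" for x
    using CD H2.span_mono[of C "C \<union> D"] H2.span_mono[of D "C \<union> D"]
    by (intro H2.span_add) auto
  then show ?thesis
    using CD card_Un_le[of C D] unfolding op_rank_le_iff
    by (intro exI[of _ "C \<union> D"]) (auto simp: blinfun.add_left)
qed

lemma op_rank_scaleR:
  assumes "op_rank s2 A \<le> enat k"
  shows "op_rank s2 (r *\<^sub>R A) \<le> enat k"
proof -
  have "r *\<^sub>R A x \<in> H2.span C" if "range A \<subseteq> H2.span C" for C x
    using that H2.span_scale[of "A x" C "of_real r"] by (auto simp: H2.scale_of_real)
  with assms show ?thesis
    unfolding op_rank_le_iff image_subset_iff by (simp add: blinfun.scaleR_left) blast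
qed

lemma op_rank_sum:
  fixes f :: "'i \<Rightarrow> 'a \<Rightarrow>\<^sub>L 'b"
  assumes "finite I" "\<And>i. i \<in> I \<Longrightarrow> op_rank s2 (f i) \<le> enat 1"
  shows "op_rank s2 (sum f I) \<le> enat (card I)"
  using assms
proof (induction I rule: finite_induct)
  case empty
  then show ?case using op_rank_0 by simp
next
  case (insert i I)
  then show ?case using op_rank_add[of "f i" 1 "sum f I" "card I"] by simp
qed

text \<open>More than \<open>k\<close> vectors in a space of dimension at most \<open>k\<close> are
  dependent. Coefficients are indexed by \<open>I\<close> because the images of the
  \<open>u i\<close> may coincide.\<close>

lemma op_rank_kernel:
  assumes lin: "linear_op T" and "op_rank s2 T \<le> enat k" and I: "finite I" "k < card I"
  shows "\<exists>c. (\<exists>i\<in>I. c i \<noteq> 0) \<and> T (\<Sum>i\<in>I. s1 (c i) (u i)) = 0"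
proof -
  obtain B where B: "finite B" "card B \<le> k" "range T \<subseteq> H2.span B"
    using assms by (auto simp: op_rank_le_iff)
  let ?w = "\<lambda>i. T (u i)"
  have T_sum: "T (\<Sum>i\<in>I. s1 (c i) (u i)) = (\<Sum>i\<in>I. s2 (c i) (?w i))" for c
    by (simp add: blinfun.sum_right linear_opD[OF lin])
  show ?thesis
  proof (cases "inj_on ?w I")
    case True
    have "H2.dependent (?w ` I)"
    proof (rule ccontr)
      assume "H2.independent (?w ` I)"
      then have "card (?w ` I) \<le> card B"
        using H2.independent_span_bound[of B "?w ` I"] B by blast
      with True I B(2) show False by (simp add: card_image)
    qed
    then obtain f where "\<exists>v\<in>?w ` I. f v \<noteq> 0" "(\<Sum>v\<in>?w ` I. s2 (f v) v) = 0"
      using H2.dependent_finite[of "?w ` I"] I by auto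
    then show ?thesis
      by (intro exI[of _ "\<lambda>i. f (?w i)"]) (simp add: T_sum sum.reindex[OF True])
  next
    case False
    then obtain i j where ij: "i \<in> I" "j \<in> I" "i \<noteq> j" "?w i = ?w j"
      by (auto simp: inj_on_def)
    \<comment> \<open>Two equal images: the difference of the two vectors lies in the
      kernel.\<close>
    define c where "c l = (if l = i then 1 else if l = j then -1 else 0 :: 'k)" for l
    have "(\<Sum>l\<in>I. s2 (c l) (?w l)) = (\<Sum>l\<in>{i, j}. s2 (c l) (?w l))"
      using ij I by (intro sum.mono_neutral_right) (auto simp: c_def)
    also have "\<dots> = 0"
      using ij by (simp add: c_def)
    finally show ?thesis
      using ij by (intro exI[of _ c]) (auto simp: T_sum c_def)
  qed
qed

end

section \<open>A top singular vector by power iteration\<close>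

text \<open>An enumeration instead of a set, so that a least index can select a vector.\<close>

definition dense_seq :: "nat \<Rightarrow> 'a::second_countable_topology"
  where "dense_seq = (SOME d. \<forall>U. open U \<longrightarrow> U \<noteq> {} \<longrightarrow> (\<exists>j. d j \<in> U))"

lemma dense_seq:
  fixes U :: "'a::second_countable_topology set"
  assumes "open U" "U \<noteq> {}"
  shows "\<exists>j. dense_seq j \<in> U"
proof -
  obtain D :: "'a set" where "countable D" and D: "\<And>U. open U \<Longrightarrow> U \<noteq> {} \<Longrightarrow> \<exists>d\<in>D. d \<in> U"
    by (erule countable_dense_setE)
  then have "D \<noteq> {}" using D[of UNIV] by auto
  with \<open>countable D\<close> D have "\<forall>U. open U \<longrightarrow> U \<noteq> {} \<longrightarrow> (\<exists>j. from_nat_into D j \<in> U)"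
    by (metis from_nat_into_surj)
  then have "\<forall>U::'a set. open U \<longrightarrow> U \<noteq> {} \<longrightarrow> (\<exists>j. dense_seq j \<in> U)"
    unfolding dense_seq_def by (rule someI[of "\<lambda>d. \<forall>U::'a set. open U \<longrightarrow> U \<noteq> {} \<longrightarrow> (\<exists>j. d j \<in> U)"])
  with assms show ?thesis by blast
qed

text \<open>The set where the bound fails is open, so it meets the dense sequence unless it is
  empty. The norm is thus controlled by countably many values.\<close>

lemma norm_blinfun_le_dense_iff:
  fixes A :: "'a::{real_normed_vector,second_countable_topology} \<Rightarrow>\<^sub>L 'b::real_normed_vector"
  assumes "0 \<le> r"
  shows "norm A \<le> r \<longleftrightarrow> (\<forall>j. norm (A (dense_seq j)) \<le> r * norm (dense_seq j :: 'a))"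
proof
  assume "norm A \<le> r"
  then show "\<forall>j. norm (A (dense_seq j)) \<le> r * norm (dense_seq j :: 'a)"
    by (meson mult_right_mono norm_blinfun norm_ge_zero order_trans)
next
  assume *: "\<forall>j. norm (A (dense_seq j)) \<le> r * norm (dense_seq j :: 'a)"
  have "open {x. r * norm x < norm (A x)}"
    by (intro open_Collect_less continuous_intros)
  note dense = dense_seq[OF this]
  have "norm (A x) \<le> r * norm x" for x
  proof (rule ccontr)
    assume "\<not> norm (A x) \<le> r * norm x"
    then have "x \<in> {x. r * norm x < norm (A x)}" by simp
    with dense obtain j where "r * norm (dense_seq j :: 'a) < norm (A (dense_seq j))" by blast
    with * show False by (meson not_le)
  qed
  with assms show "norm A \<le> r"
    by (intro norm_blinfun_bound) auto
qed

lemma ex_norm_blinfun_approx: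
  fixes A :: "'a::real_normed_vector \<Rightarrow>\<^sub>L 'b::real_normed_vector"
  assumes "r < norm A" "0 \<le> r"
  shows "\<exists>x. norm x = 1 \<and> r < norm (A x)"
proof -
  obtain x where x: "r * norm x < norm (A x)"
    using assms norm_blinfun_bound[of r A] by (meson not_le)
  with assms have "x \<noteq> 0" by (auto simp: blinfun.zero_right)
  with x show ?thesis
    by (intro exI[of _ "sgn x"]) (simp add: sgn_div_norm blinfun.scaleR_right norm_sgn field_simps)
qed

context hilbert_pair
begin

text \<open>
  A maximizing sequence \<open>X\<close> satisfies \<open>\<parallel>A\<^sup>* A X - \<parallel>A\<parallel>\<^sup>2 X\<parallel> \<rightarrow> 0\<close>, so compactness of \<open>A\<close> makes it converge.
\<close>

lemma norm_adj_sub_sq_le: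
  assumes "linear_op A" "norm x = 1"
  shows "(norm (adj A (A x) - (norm A)\<^sup>2 *\<^sub>R x))\<^sup>2 \<le> (norm A)\<^sup>2 * ((norm A)\<^sup>2 - (norm (A x))\<^sup>2)"
proof -
  have "(norm (adj A (A x)))\<^sup>2 \<le> (norm A * norm (A x))\<^sup>2"
    using assms by (intro power_mono norm_adj_apply_le) auto
  moreover have "H1.rip (adj A (A x)) ((norm A)\<^sup>2 *\<^sub>R x) = (norm A)\<^sup>2 * (norm (A x))\<^sup>2"
    by (simp add: H1.rip_scaleR_right H1.rip_commute[of _ x] H2.rip_self flip: rip_adj[OF assms(1)])
  ultimately show ?thesis
    using assms by (simp add: H1.norm_diff_sq algebra_simps power_mult_distrib)
qed

text \<open>At a unit vector where the norm is attained, the right-hand side of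
  \<open>norm_adj_sub_sq_le\<close> vanishes.\<close>

lemma norm_attained_imp_adj:
  assumes "linear_op A" and norm_eq: "norm (A x) = norm A * norm x"
  shows "adj A (A x) = (norm A)\<^sup>2 *\<^sub>R x"
proof (cases "x = 0")
  case True
  then show ?thesis by (simp add: blinfun.zero_right)
next
  case False
  have "norm (A (sgn x)) = norm A"
    using norm_eq False by (simp add: sgn_div_norm blinfun.scaleR_right)
  then have "adj A (A (sgn x)) = (norm A)\<^sup>2 *\<^sub>R sgn x"
    using norm_adj_sub_sq_le[OF assms(1), of "sgn x"] False by (simp add: norm_sgn)
  then have "adj A (A (norm x *\<^sub>R sgn x)) = (norm A)\<^sup>2 *\<^sub>R (norm x *\<^sub>R sgn x)"
    by (simp add: blinfun.scaleR_right mult.commute)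
  moreover have "norm x *\<^sub>R sgn x = x"
    using False by (simp add: sgn_div_norm)
  ultimately show ?thesis
    by metis
qed

lemma ex_norm_attained:
  assumes A: "A \<in> compact_ops s1 s2" and "A \<noteq> 0"
  shows "\<exists>w. norm w = 1 \<and> adj A (A w) = (norm A)\<^sup>2 *\<^sub>R w"
proof -
  note lin = compact_ops_linear[OF A]
  define s where "s = norm A"
  have "s > 0" using assms by (simp add: s_def)
  have "\<exists>x. norm x = 1 \<and> s - s / Suc k < norm (A x)" for k
    using \<open>s > 0\<close> by (intro ex_norm_blinfun_approx) (auto simp: s_def field_simps)
  then obtain X where X: "\<And>k. norm (X k) = 1" "\<And>k. s - s / Suc k < norm (A (X k))"
    by metis
  have AX_le: "norm (A (X k)) \<le> s" for k
    using norm_blinfun[of A "X k"] X(1)[of k] by (simp add: s_def)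
  have lim_s: "(\<lambda>k. norm (A (X k))) \<longlonglongrightarrow> s"
  proof (rule tendsto_sandwich)
    show "(\<lambda>k. s - s * inverse (real (Suc k))) \<longlonglongrightarrow> s"
      using tendsto_diff[OF tendsto_const tendsto_mult[OF tendsto_const LIMSEQ_inverse_real_of_nat], of s s]
      by simp
    have "s - s * inverse (real (Suc k)) \<le> norm (A (X k))" for k
      using X(2)[of k] by (simp only: divide_inverse less_imp_le)
    then show "\<forall>\<^sub>F k in sequentially. s - s * inverse (real (Suc k)) \<le> norm (A (X k))"
      by (rule always_eventually[OF allI])
    show "\<forall>\<^sub>F k in sequentially. norm (A (X k)) \<le> s"
      using AX_le by (rule always_eventually[OF allI])
  qed (rule tendsto_const)
  obtain K where K: "compact K" "A ` cball 0 1 \<subseteq> K"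
    using A by (rule compact_ops_D)
  then have "\<forall>k. A (X k) \<in> K" using X(1) by auto
  with compact_imp_seq_compact[OF K(1)]
  obtain l r where r: "strict_mono r" "(\<lambda>k. A (X (r k))) \<longlonglongrightarrow> l"
    by (elim seq_compactE[where f = "\<lambda>k. A (X k)"]) (auto simp: comp_def)
  have "norm l = s"
    using LIMSEQ_unique[OF tendsto_norm[OF r(2)]] LIMSEQ_subseq_LIMSEQ[OF lim_s r(1)]
    by (simp add: comp_def)
  define e where "e k = adj A (A (X (r k))) - s\<^sup>2 *\<^sub>R X (r k)" for k
  have "(\<lambda>k. s\<^sup>2 * (s\<^sup>2 - (norm (A (X (r k))))\<^sup>2)) \<longlonglongrightarrow> s\<^sup>2 * (s\<^sup>2 - (norm l)\<^sup>2)"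
    by (intro tendsto_intros r(2))
  then have "(\<lambda>k. s\<^sup>2 * (s\<^sup>2 - (norm (A (X (r k))))\<^sup>2)) \<longlonglongrightarrow> 0"
    by (simp add: \<open>norm l = s\<close>)
  moreover have "norm ((norm (e k))\<^sup>2) \<le> s\<^sup>2 * (s\<^sup>2 - (norm (A (X (r k))))\<^sup>2)" for k
    using norm_adj_sub_sq_le[OF lin] X(1) by (simp add: e_def s_def)
  ultimately have "(\<lambda>k. (norm (e k))\<^sup>2) \<longlonglongrightarrow> 0"
    by (rule Lim_null_comparison[OF always_eventually[OF allI], rotated])
  then have "(\<lambda>k. sqrt ((norm (e k))\<^sup>2)) \<longlonglongrightarrow> sqrt 0"
    by (rule tendsto_real_sqrt)
  then have "e \<longlonglongrightarrow> 0"
    by (simp add: tendsto_norm_zero_iff)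
  \<comment> \<open>The definition of \<open>e\<close> is solved for \<open>X (r k)\<close>; both
    remaining terms converge.\<close>
  then have "(\<lambda>k. inverse (s\<^sup>2) *\<^sub>R (adj A (A (X (r k))) - e k)) \<longlonglongrightarrow> inverse (s\<^sup>2) *\<^sub>R (adj A l - 0)"
    by (intro tendsto_intros r(2))
  moreover define w where "w = inverse (s\<^sup>2) *\<^sub>R adj A l"
  ultimately have w: "(\<lambda>k. X (r k)) \<longlonglongrightarrow> w"
    using \<open>s > 0\<close> by (simp add: e_def)
  have "norm w = 1"
    using tendsto_norm[OF w] X(1) by (simp add: LIMSEQ_const_iff)
  moreover have "A w = l"
    using LIMSEQ_unique[OF _ r(2)] w by (simp add: blinfun.tendsto)
  ultimately show ?thesis
    using norm_attained_imp_adj[OF lin, of w] \<open>norm l = s\<close> s_def by auto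
qed

section \<open>Power iteration\<close>

text \<open>A positive contraction B; for \<open>A = 0\<close> the convention
  \<open>inverse 0 = 0\<close> makes it the zero map.\<close>

definition pow_step :: "('a \<Rightarrow>\<^sub>L 'b) \<Rightarrow> 'a \<Rightarrow> 'a"
  where "pow_step A x = inverse ((norm A)\<^sup>2) *\<^sub>R adj A (A x)"

definition pow_lim :: "('a \<Rightarrow>\<^sub>L 'b) \<Rightarrow> 'a \<Rightarrow> 'a"
  where "pow_lim A x = lim (\<lambda>m. (pow_step A ^^ m) x)"

lemma rip_pow_step:
  assumes "linear_op A"
  shows "H1.rip (pow_step A x) y = inverse ((norm A)\<^sup>2) * H2.rip (A x) (A y)"
  by (simp add: pow_step_def H1.rip_scaleR_left H1.rip_scaleR_right H1.rip_commute[of _ y] H2.rip_commute[of _ "A y"]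
      rip_adj[OF assms])

lemma rip_pow_step_commute:
  assumes "linear_op A"
  shows "H1.rip (pow_step A x) y = H1.rip x (pow_step A y)"
  using rip_pow_step[OF assms, of x y] rip_pow_step[OF assms, of y x]
  by (simp add: H1.rip_commute[of x] H2.rip_commute[of "A x"])

lemma rip_pow_step_funpow_commute:
  assumes "linear_op A"
  shows "H1.rip ((pow_step A ^^ m) x) y = H1.rip x ((pow_step A ^^ m) y)"
proof (induction m arbitrary: y)
  case (Suc m)
  have "H1.rip ((pow_step A ^^ Suc m) x) y = H1.rip ((pow_step A ^^ m) x) (pow_step A y)"
    by (simp add: rip_pow_step_commute[OF assms])
  also have "\<dots> = H1.rip x ((pow_step A ^^ Suc m) y)"
    by (simp add: Suc.IH funpow_swap1)
  finally show ?case .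
qed simp

text \<open>These are B^2 \<le> B \<le> I as quadratic forms; the middle term is the square of
  \<open>norm (A x) / norm A\<close>.\<close>

lemma norm_pow_step_le:
  assumes "linear_op A"
  shows "(norm (pow_step A x))\<^sup>2 \<le> H1.rip (pow_step A x) x"
    and "H1.rip (pow_step A x) x \<le> (norm x)\<^sup>2"
proof -
  have rip: "H1.rip (pow_step A x) x = (norm (A x) / norm A)\<^sup>2"
    by (simp add: rip_pow_step[OF assms] H2.rip_self power_divide field_simps)
  have "norm (pow_step A x) \<le> inverse ((norm A)\<^sup>2) * (norm A * norm (A x))"
    unfolding pow_step_def by (simp add: norm_adj_apply_le[OF assms] mult_left_mono)
  also have "\<dots> = norm (A x) / norm A"
    by (simp add: power2_eq_square field_simps)
  finally show "(norm (pow_step A x))\<^sup>2 \<le> H1.rip (pow_step A x) x"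
    unfolding rip by (intro power_mono) auto
  show "H1.rip (pow_step A x) x \<le> (norm x)\<^sup>2"
    unfolding rip using norm_blinfun[of A x]
    by (intro power_mono) (auto simp: divide_le_eq mult.commute)
qed

text \<open>
  For \<open>B = A\<^sup>* A / \<parallel>A\<parallel>\<^sup>2\<close> the numbers \<open>a m = \<langle>B\<^sup>m x, x\<rangle>\<close> decrease to a limit, and
  \<open>\<parallel>B\<^sup>i x - B\<^sup>j x\<parallel>\<^sup>2 = a (2 i) - 2 a (i + j) + a (2 j)\<close>.
\<close>

lemma pow_lim_LIMSEQ:
  assumes lin: "linear_op A"
  shows "(\<lambda>m. (pow_step A ^^ m) x) \<longlonglongrightarrow> pow_lim A x"
proof -
  define X where "X m = (pow_step A ^^ m) x" for m
  define a where "a m = H1.rip (X m) x" for m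
  have rip_X: "H1.rip (X i) (X j) = a (i + j)" for i j
    by (metis H1.rip_commute X_def a_def comp_apply funpow_add rip_pow_step_funpow_commute[OF lin])
  have sq: "(norm (X i - X j))\<^sup>2 = a (2 * i) - 2 * a (i + j) + a (2 * j)" for i j
    using rip_X[of i i] rip_X[of j j] by (simp add: H1.norm_diff_sq H1.rip_self rip_X[of i j] mult_2[of i] mult_2[of j])
  have X_Suc: "X (Suc m) = pow_step A (X m)" for m
    by (simp add: X_def)
  \<comment> \<open>Splitting the power evenly gives quadratic forms at one vector
    \<open>X k\<close>: even \<open>m\<close> uses B \<le> I, odd \<open>m\<close> uses B^2 \<le>
    B.\<close>
  have a_Suc: "a (Suc m) \<le> a m \<and> 0 \<le> a m" for m
  proof (cases "even m")
    case True
    then obtain k where "m = k + k" by (auto elim!: evenE simp: mult_2)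
    then show ?thesis
      using norm_pow_step_le(2)[OF lin, of "X k"] rip_X[of k k] rip_X[of "Suc k" k]
      by (simp add: X_Suc H1.rip_self) (metis zero_le_power2)
  next
    case False
    then obtain k where m: "m = Suc k + k" by (auto elim!: oddE simp: mult_2)
    have "a (Suc m) = (norm (X (Suc k)))\<^sup>2" "a m = H1.rip (X (Suc k)) (X k)"
      using rip_X[of "Suc k" "Suc k"] rip_X[of "Suc k" k] m by (simp_all add: H1.rip_self)
    then show ?thesis
      using norm_pow_step_le(1)[OF lin, of "X k"]
      by (simp add: X_Suc) (meson order_trans zero_le_power2)
  qed
  then have "convergent a"
    by (intro Bseq_monoseq_convergent decseq_imp_monoseq decseq_SucI decseq_bounded) auto
  then have "Cauchy a" by (simp add: Cauchy_convergent_iff)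
  have "Cauchy X"
  proof (rule metric_CauchyI)
    fix e :: real assume "e > 0"
    then obtain N where N: "\<And>i j. i \<ge> N \<Longrightarrow> j \<ge> N \<Longrightarrow> dist (a i) (a j) < e\<^sup>2 / 2"
      using metric_CauchyD[OF \<open>Cauchy a\<close>, of "e\<^sup>2 / 2"] by auto
    have "dist (X i) (X j) < e" if "i \<ge> N" "j \<ge> N" for i j
    proof -
      have "(norm (X i - X j))\<^sup>2 < e\<^sup>2"
        using N[of "2 * i" "i + j"] N[of "2 * j" "i + j"] that
        unfolding sq dist_real_def by linarith
      then show ?thesis
        using \<open>e > 0\<close> by (auto simp: dist_norm intro: power2_less_imp_less)
    qed
    then show "\<exists>M. \<forall>m\<ge>M. \<forall>n\<ge>M. dist (X m) (X n) < e" by blast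
  qed
  then show ?thesis
    by (simp add: Cauchy_convergent_iff convergent_LIMSEQ_iff pow_lim_def flip: X_def)
qed

lemma pow_lim_0: "pow_lim 0 x = 0"
proof -
  \<comment> \<open>The shift skips the zeroth iterate, which is \<open>x\<close> itself.\<close>
  have "(\<lambda>m. (pow_step 0 ^^ Suc m) x) \<longlonglongrightarrow> pow_lim 0 x"
    using pow_lim_LIMSEQ[OF linear_op_0] by (rule LIMSEQ_Suc)
  then show ?thesis
    by (simp add: pow_step_def LIMSEQ_const_iff)
qed

text \<open>A limit of iterates is a fixed point of the continuous map
  \<open>pow_step A\<close>.\<close>

lemma adj_pow_lim:
  assumes lin: "linear_op A"
  shows "adj A (A (pow_lim A x)) = (norm A)\<^sup>2 *\<^sub>R pow_lim A x"
proof (cases "A = 0")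
  case True
  then show ?thesis by (simp add: pow_lim_0 blinfun.zero_right)
next
  case False
  have "(\<lambda>m. pow_step A ((pow_step A ^^ m) x)) \<longlonglongrightarrow> pow_step A (pow_lim A x)"
    unfolding pow_step_def by (intro tendsto_intros pow_lim_LIMSEQ[OF lin, unfolded pow_step_def])
  moreover have "(\<lambda>m. pow_step A ((pow_step A ^^ m) x)) \<longlonglongrightarrow> pow_lim A x"
    using LIMSEQ_Suc[OF pow_lim_LIMSEQ[OF lin]] by simp
  ultimately have "pow_step A (pow_lim A x) = pow_lim A x"
    by (rule LIMSEQ_unique)
  then have "(norm A)\<^sup>2 *\<^sub>R pow_step A (pow_lim A x) = (norm A)\<^sup>2 *\<^sub>R pow_lim A x" by simp
  with False show ?thesis by (simp add: pow_step_def)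
qed

text \<open>Let \<open>w\<close> be a unit fixed vector. As the step is symmetric, iterates of
  \<open>d\<close> all have the same real inner product with \<open>w\<close>, and so does their
  limit; it remains to take \<open>d\<close> with a positive one.\<close>

lemma ex_pow_lim_nonzero:
  assumes A: "A \<in> compact_ops s1 s2" and "A \<noteq> 0"
  shows "\<exists>j. pow_lim A (dense_seq j) \<noteq> 0"
proof -
  note lin = compact_ops_linear[OF A]
  obtain w where w: "norm w = 1" "adj A (A w) = (norm A)\<^sup>2 *\<^sub>R w"
    using ex_norm_attained[OF assms] by blast
  then have "pow_step A w = w"
    using \<open>A \<noteq> 0\<close> by (simp add: pow_step_def)
  then have fix_w: "(pow_step A ^^ m) w = w" for m
    by (induction m) auto
  have "open {x. 0 < H1.rip x w}"
    by (intro open_Collect_less continuous_intros linear_continuous_on H1.bounded_linear_rip_left)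
  moreover have "w \<in> {x. 0 < H1.rip x w}"
    using w by (simp add: H1.rip_self)
  ultimately obtain j where j: "0 < H1.rip (dense_seq j) w"
    using dense_seq by blast
  have "(\<lambda>m. H1.rip ((pow_step A ^^ m) (dense_seq j)) w) \<longlonglongrightarrow> H1.rip (pow_lim A (dense_seq j)) w"
    by (intro bounded_linear.tendsto[OF H1.bounded_linear_rip_left] pow_lim_LIMSEQ lin)
  then have "H1.rip (dense_seq j) w = H1.rip (pow_lim A (dense_seq j)) w"
    by (simp add: rip_pow_step_funpow_commute[OF lin] fix_w LIMSEQ_const_iff)
  with j have "H1.rip (pow_lim A (dense_seq j)) w \<noteq> 0" by simp
  then have "pow_lim A (dense_seq j) \<noteq> 0"
    using H1.rip_scaleR_left[of 0 w w] by auto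
  then show ?thesis ..
qed

text \<open>The least index makes the choice measurable. For \<open>A = 0\<close> every limit is
  zero, and so is the result, whatever index \<open>LEAST\<close> returns.\<close>

definition top_vec :: "('a \<Rightarrow>\<^sub>L 'b) \<Rightarrow> 'a"
  where "top_vec A = sgn (pow_lim A (dense_seq (LEAST j. pow_lim A (dense_seq j) \<noteq> 0)))"

lemma top_vec_0: "top_vec 0 = 0"
  by (simp add: top_vec_def pow_lim_0)

lemma adj_top_vec:
  assumes "linear_op A"
  shows "adj A (A (top_vec A)) = (norm A)\<^sup>2 *\<^sub>R top_vec A"
  by (simp add: top_vec_def sgn_div_norm blinfun.scaleR_right adj_pow_lim[OF assms])

lemma norm_top_vec:
  assumes "A \<in> compact_ops s1 s2" and "A \<noteq> 0"
  shows "norm (top_vec A) = 1"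
  using LeastI_ex[OF ex_pow_lim_nonzero[OF assms]] by (simp add: top_vec_def norm_sgn)

end

section \<open>Deflation\<close>

context hilbert_space
begin

lemma ip_scale_right: "to_complex (ip x (scale c y)) = cnj (to_complex c) * to_complex (ip x y)"
  by (metis complex_cnj_mult ip_cnj_commute ip_scale_left to_complex_mult)

lemma ip_scale_right_eq_0: "ip x y = 0 \<Longrightarrow> ip x (scale c y) = 0"
  by (simp add: ip_eq_0_commute[of x] ip_scale_left)

lemma norm_sum_orthogonal_sq:
  assumes "finite I" and "\<And>i j. i \<in> I \<Longrightarrow> j \<in> I \<Longrightarrow> i \<noteq> j \<Longrightarrow> ip (w i) (w j) = 0"
  shows "(norm (\<Sum>i\<in>I. w i))\<^sup>2 = (\<Sum>i\<in>I. (norm (w i))\<^sup>2)"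
  using assms
proof (induction I rule: finite_induct)
  case (insert i I)
  have "ip (\<Sum>j\<in>I. w j) (w i) = 0"
    unfolding ip_sum_left by (intro sum.neutral ballI insert.prems) (use insert.hyps in auto)
  then have "ip (w i) (\<Sum>j\<in>I. w j) = 0"
    using ip_eq_0_commute by blast
  then have "rip (w i) (\<Sum>j\<in>I. w j) = 0"
    by (simp add: rip_def to_complex_0)
  then show ?case
    using insert by (simp add: norm_add_sq)
qed simp

lemma norm_minus_projection_le:
  assumes "norm u = 1"
  shows "norm (x - scale (ip x u) u) \<le> norm x"
proof -
  let ?p = "scale (ip x u) u"
  have "ip (x - ?p) u = 0"
    by (simp add: ip_diff_left ip_scale_left ip_unit[OF assms])
  then have "ip (x - ?p) ?p = 0"
    by (rule ip_scale_right_eq_0)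
  then have "(norm (x - ?p + ?p))\<^sup>2 = (norm (x - ?p))\<^sup>2 + (norm ?p)\<^sup>2"
    by (subst norm_add_sq) (simp add: rip_def to_complex_0)
  then have "(norm (x - ?p))\<^sup>2 \<le> (norm x)\<^sup>2"
    by simp
  then show ?thesis
    by (rule power2_le_imp_le) simp
qed

end

context hilbert_pair
begin

lemma adj_rank_one: "adj (rank_one u v) = rank_one_op ip2 s1 v u"
proof (rule adj_eqI)
  interpret swap: hilbert_pair s2 ip2 s1 ip1 ..
  fix x y
  have "to_complex (ip2 (s2 (ip1 x u) v) y) = to_complex (ip1 x (s1 (ip2 y v) u))"
    by (simp add: H2.ip_scale_left H1.ip_scale_right to_complex_mult H2.ip_cnj_commute[of v y])
  then show "ip2 (rank_one u v x) y = ip1 x (rank_one_op ip2 s1 v u y)"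
    by (simp add: rank_one_apply swap.rank_one_apply to_complex_inject)
qed

section \<open>Singular values as distances to operators of bounded rank\<close>

text \<open>Singular values count from one; at \<open>Suc k\<close> the rank bound
  \<open>i - 1\<close> becomes \<open>k\<close>.\<close>

lemma sing_val_le:
  assumes "L \<in> compact_ops s1 s2" "op_rank s2 L \<le> enat k"
  shows "sing_val s1 s2 (Suc k) A \<le> norm (A - L)"
  unfolding sing_val_def
  by (rule cInf_lower) (use assms in \<open>auto intro!: bdd_belowI[of _ 0]\<close>)

lemma sing_val_greatest:
  assumes "\<And>L. L \<in> compact_ops s1 s2 \<Longrightarrow> op_rank s2 L \<le> enat k \<Longrightarrow> r \<le> norm (A - L)"
  shows "r \<le> sing_val s1 s2 (Suc k) A"
  unfolding sing_val_def
  by (rule cInf_greatest) (use assms compact_ops_0 op_rank_0 in \<open>simp, blast, auto\<close>)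

lemma sing_val_nonneg: "0 \<le> sing_val s1 s2 (Suc k) A"
  by (rule sing_val_greatest) simp

text \<open>If \<open>M\<close> of rank at most \<open>i\<close> approximates \<open>A - L\<close>,
  then \<open>L + M\<close> of rank at most \<open>n + i\<close> approximates \<open>A\<close> with
  the same error. This is the lower bound behind Hilbert-Schmidt optimality.\<close>

lemma sing_val_diff_ge:
  assumes "L \<in> compact_ops s1 s2" "op_rank s2 L \<le> enat n"
  shows "sing_val s1 s2 (Suc (n + i)) A \<le> sing_val s1 s2 (Suc i) (A - L)"
proof (rule sing_val_greatest)
  fix M assume "M \<in> compact_ops s1 s2" "op_rank s2 M \<le> enat i"
  then have "sing_val s1 s2 (Suc (n + i)) A \<le> norm (A - (L + M))"
    using assms by (intro sing_val_le compact_ops_add op_rank_add)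
  then show "sing_val s1 s2 (Suc (n + i)) A \<le> norm (A - L - M)"
    by (simp add: diff_diff_add)
qed

lemma hs_norm_mono:
  assumes "\<And>i. sing_val s1 s2 (Suc i) A \<le> sing_val s1 s2 (Suc i) B"
  shows "hs_norm s1 s2 A \<le> hs_norm s1 s2 B"
proof (cases "summable (\<lambda>i. (sing_val s1 s2 (Suc i) B)\<^sup>2)")
  case True
  have le: "(sing_val s1 s2 (Suc i) A)\<^sup>2 \<le> (sing_val s1 s2 (Suc i) B)\<^sup>2" for i
    by (intro power_mono assms sing_val_nonneg)
  then have "summable (\<lambda>i. (sing_val s1 s2 (Suc i) A)\<^sup>2)"
    by (intro summable_comparison_test'[OF True]) auto
  then show ?thesis
    using True le by (simp add: hs_norm_def suminf_le)
qed (simp add: hs_norm_def)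

end

text \<open>The choice of the top vector is left open, so that deflation is treated once for general
  operators and once more, by instantiation, for the self-adjoint case. Here \<open>'b\<close> and
  \<open>'c\<close> are the types of domain and codomain; \<open>sel_0\<close> makes all vectors
  vanish once the remainder is zero.\<close>

locale top_selector = hilbert_pair +
  fixes sel :: "('b \<Rightarrow>\<^sub>L 'c) \<Rightarrow> 'b"
  assumes adj_sel: "A \<in> compact_ops s1 s2 \<Longrightarrow> adj A (A (sel A)) = (norm A)\<^sup>2 *\<^sub>R sel A"
    and norm_sel: "A \<in> compact_ops s1 s2 \<Longrightarrow> A \<noteq> 0 \<Longrightarrow> norm (sel A) = 1"
    and sel_0: "sel 0 = 0"
begin

definition left :: "('b \<Rightarrow>\<^sub>L 'c) \<Rightarrow> 'c"
  where "left A = inverse (norm A) *\<^sub>R A (sel A)"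

definition deflate :: "('b \<Rightarrow>\<^sub>L 'c) \<Rightarrow> ('b \<Rightarrow>\<^sub>L 'c)"
  where "deflate A = A - norm A *\<^sub>R rank_one (sel A) (left A)"

definition resid :: "('b \<Rightarrow>\<^sub>L 'c) \<Rightarrow> nat \<Rightarrow> ('b \<Rightarrow>\<^sub>L 'c)"
  where "resid A k = (deflate ^^ k) A"

lemma left_0: "left 0 = 0"
  by (simp add: left_def)

lemma apply_sel: "A (sel A) = norm A *\<^sub>R left A"
  by (cases "A = 0") (simp_all add: left_def)

lemma norm_left:
  assumes "A \<in> compact_ops s1 s2" "A \<noteq> 0"
  shows "norm (left A) = 1"
proof -
  have "(norm (A (sel A)))\<^sup>2 = H1.rip (sel A) (adj A (A (sel A)))"
    by (simp add: H2.rip_self flip: rip_adj[OF compact_ops_linear[OF assms(1)]])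
  also have "\<dots> = (norm A)\<^sup>2"
    using norm_sel[OF assms] by (simp add: adj_sel[OF assms(1)] H1.rip_scaleR_right H1.rip_self)
  finally have "norm (A (sel A)) = norm A" by simp
  with assms(2) show ?thesis by (simp add: left_def)
qed

lemma adj_left:
  assumes "A \<in> compact_ops s1 s2"
  shows "adj A (left A) = norm A *\<^sub>R sel A"
  by (cases "A = 0")
     (simp_all add: left_0 left_def blinfun.scaleR_right adj_sel[OF assms] power2_eq_square)

lemma compact_ops_deflate: "A \<in> compact_ops s1 s2 \<Longrightarrow> deflate A \<in> compact_ops s1 s2"
  by (simp add: deflate_def compact_ops_diff compact_ops_scaleR compact_ops_rank_one)

lemma deflate_apply: "deflate A x = A x - norm A *\<^sub>R s2 (ip1 x (sel A)) (left A)"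
  by (simp add: deflate_def blinfun.diff_left blinfun.scaleR_left rank_one_apply)

lemma adj_deflate:
  assumes "A \<in> compact_ops s1 s2"
  shows "adj (deflate A) = adj A - norm A *\<^sub>R rank_one_op ip2 s1 (left A) (sel A)"
  by (simp add: deflate_def adj_diff adj_scaleR linear_op_scaleR linear_op_rank_one adj_rank_one
      compact_ops_linear[OF assms])

lemma adj_deflate_apply:
  assumes "A \<in> compact_ops s1 s2"
  shows "adj (deflate A) y = adj A y - norm A *\<^sub>R s1 (ip2 y (left A)) (sel A)"
proof -
  interpret swap: hilbert_pair s2 ip2 s1 ip1 ..
  show ?thesis
    by (simp add: adj_deflate[OF assms] blinfun.diff_left blinfun.scaleR_left swap.rank_one_apply)
qed

text \<open>Kernels grow under deflation: \<open>norm A *\<^sub>R sel A\<close> is in the range of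
  \<open>adj A\<close>, hence orthogonal to the kernel of \<open>A\<close>, and the subtracted term
  vanishes there.\<close>

lemma deflate_kernel:
  assumes "A \<in> compact_ops s1 s2" "A x = 0"
  shows "deflate A x = 0"
proof -
  have "norm A *\<^sub>R ip1 x (sel A) = ip2 (A x) (left A)"
    by (simp add: ip_adj compact_ops_linear adj_left assms(1) H1.ip_scaleR_right)
  with assms(2) show ?thesis
    by (simp add: deflate_apply H2.scaleR_scale)
qed

lemma adj_deflate_kernel:
  assumes "A \<in> compact_ops s1 s2" "adj A y = 0"
  shows "adj (deflate A) y = 0"
proof -
  have "ip2 (A (sel A)) y = 0"
    by (simp add: ip_adj compact_ops_linear assms)
  then have "norm A *\<^sub>R ip2 y (left A) = 0"
    by (simp add: apply_sel H2.ip_eq_0_commute[of _ y] H2.ip_scaleR_right)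
  with assms show ?thesis
    by (simp add: adj_deflate_apply H1.scaleR_scale)
qed

lemma deflate_sel: "A \<in> compact_ops s1 s2 \<Longrightarrow> deflate A (sel A) = 0"
  by (cases "A = 0") (simp_all add: deflate_apply apply_sel H1.ip_unit norm_sel)

lemma adj_deflate_left: "A \<in> compact_ops s1 s2 \<Longrightarrow> adj (deflate A) (left A) = 0"
  by (cases "A = 0")
     (simp_all add: left_0 adj_deflate_apply adj_left H2.ip_unit norm_left)

text \<open>Deflation is \<open>A\<close> composed with the projection onto the orthogonal
  complement of \<open>sel A\<close>.\<close>

lemma norm_deflate_le:
  assumes "A \<in> compact_ops s1 s2"
  shows "norm (deflate A) \<le> norm A"
proof (cases "A = 0")
  case False
  have "deflate A x = A (x - s1 (ip1 x (sel A)) (sel A))" for x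
    by (simp add: deflate_apply blinfun.diff_right linear_opD[OF compact_ops_linear[OF assms]]
        apply_sel H2.scale_scaleR)
  then have "norm (deflate A x) \<le> norm A * norm x" for x
    using norm_blinfun[of A "x - s1 (ip1 x (sel A)) (sel A)"]
      H1.norm_minus_projection_le[OF norm_sel[OF assms False], of x]
    by (metis mult_left_mono norm_ge_zero order_trans)
  then show ?thesis
    by (intro norm_blinfun_bound) auto
qed (simp add: deflate_def)

end

section \<open>Singular value expansion of one operator\<close>

locale compact_operator = top_selector +
  fixes A :: "'b \<Rightarrow>\<^sub>L 'c"
  assumes A: "A \<in> compact_ops s1 s2"
begin

abbreviation R :: "nat \<Rightarrow> ('b \<Rightarrow>\<^sub>L 'c)" where "R \<equiv> resid A"
text \<open>Counting starts at zero: \<open>s k\<close> turns out to be the singular value number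
  \<open>Suc k\<close>.\<close>

abbreviation s :: "nat \<Rightarrow> real" where "s k \<equiv> norm (R k)"
abbreviation u :: "nat \<Rightarrow> 'b" where "u k \<equiv> sel (R k)"
abbreviation v :: "nat \<Rightarrow> 'c" where "v k \<equiv> left (R k)"

lemma R_0: "R 0 = A"
  and R_Suc: "R (Suc k) = deflate (R k)"
  by (simp_all add: resid_def)

lemma R_compact: "R k \<in> compact_ops s1 s2"
  by (induction k) (simp_all add: R_0 R_Suc A compact_ops_deflate)

lemma R_add: "resid (R n) i = R (n + i)"
  by (simp add: resid_def funpow_add add.commute[of n])

lemma s_antimono: "i \<le> k \<Longrightarrow> s k \<le> s i"
  by (rule lift_Suc_antimono_le[of s]) (simp_all add: R_Suc norm_deflate_le R_compact)

text \<open>Deflation number \<open>i\<close> kills \<open>u i\<close>, and later deflations keep it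
  in the kernel.\<close>

lemma R_u: "i < k \<Longrightarrow> R k (u i) = 0"
proof (induction k)
  case (Suc k)
  then show ?case
    by (cases "i = k") (simp_all add: R_Suc deflate_sel deflate_kernel R_compact)
qed simp

lemma adj_R_v: "i < k \<Longrightarrow> adj (R k) (v i) = 0"
proof (induction k)
  case (Suc k)
  then show ?case
    by (cases "i = k") (simp_all add: R_Suc adj_deflate_left adj_deflate_kernel R_compact)
qed simp

text \<open>For \<open>i < j\<close> the vector \<open>u i\<close> lies in the kernel of
  \<open>R j\<close>, while \<open>s j *\<^sub>R u j\<close> lies in the range of its adjoint. If
  \<open>s j = 0\<close>, then \<open>u j = 0\<close>.\<close>

lemma u_orthogonal: "i \<noteq> j \<Longrightarrow> ip1 (u i) (u j) = 0"
proof (induction i j rule: linorder_wlog)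
  case (le i j)
  have "s j *\<^sub>R ip1 (u i) (u j) = ip2 (R j (u i)) (v j)"
    by (simp add: ip_adj compact_ops_linear adj_left R_compact H1.ip_scaleR_right)
  then have "s j *\<^sub>R ip1 (u i) (u j) = 0"
    using le by (simp add: R_u)
  then show ?case by (auto simp: sel_0)
next
  case (sym i j)
  then show ?case using H1.ip_eq_0_commute by blast
qed

lemma v_orthogonal: "i \<noteq> j \<Longrightarrow> ip2 (v i) (v j) = 0"
proof (induction i j rule: linorder_wlog)
  case (le i j)
  have "ip2 (R j (u j)) (v i) = 0"
    using le by (simp add: ip_adj compact_ops_linear adj_R_v R_compact)
  then have "s j *\<^sub>R ip2 (v j) (v i) = 0"
    by (simp add: apply_sel H2.ip_scaleR_left)
  then show ?case
    using H2.ip_eq_0_commute[of "v i" "v j"] by (auto simp: left_0)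
next
  case (sym i j)
  then show ?case using H2.ip_eq_0_commute by blast
qed

text \<open>Zero-based counterpart of \<open>truncation\<close>, with norms of remainders as
  coefficients until \<open>sing_val_eq\<close> identifies them.\<close>

definition trunc :: "nat \<Rightarrow> ('b \<Rightarrow>\<^sub>L 'c)"
  where "trunc k = (\<Sum>i<k. s i *\<^sub>R rank_one (u i) (v i))"

lemma A_minus_trunc: "A - trunc k = R k"
proof (induction k)
  case (Suc k)
  then show ?case by (simp add: trunc_def R_Suc deflate_def flip: diff_diff_add)
qed (simp add: trunc_def R_0)

lemma trunc_compact: "trunc k \<in> compact_ops s1 s2"
  unfolding trunc_def by (intro compact_ops_sum compact_ops_scaleR compact_ops_rank_one)

lemma trunc_rank: "op_rank s2 (trunc k) \<le> enat k"
  unfolding trunc_def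
  using op_rank_sum[OF _ op_rank_scaleR[OF op_rank_rank_one], of "{..<k}" s u v] by simp

lemma trunc_apply: "trunc k x = (\<Sum>i<k. s i *\<^sub>R s2 (ip1 x (u i)) (v i))"
  by (simp add: trunc_def blinfun.sum_left blinfun.scaleR_left rank_one_apply)

lemma A_eq: "A x = R k x + trunc k x"
  by (simp flip: A_minus_trunc[of k] add: blinfun.diff_left)

text \<open>By orthogonality \<open>trunc k\<close> vanishes at \<open>u k\<close>, so
  \<open>A\<close> acts there as \<open>R k\<close> does.\<close>

lemma A_u: "A (u k) = s k *\<^sub>R v k"
  using A_eq[of "u k" k] by (simp add: apply_sel trunc_apply u_orthogonal)

lemma adj_A_v: "adj A (v k) = s k *\<^sub>R u k"
proof (rule H1.ip_right_inject)
  fix x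
  have "ip2 (trunc k x) (v k) = 0"
    by (simp add: trunc_apply H2.ip_sum_left H2.ip_scaleR_left H2.ip_scale_left v_orthogonal)
  then have "ip2 (A x) (v k) = ip2 (R k x) (v k)"
    by (simp add: A_eq[of x k] H2.ip_add_left)
  then show "ip1 x (adj A (v k)) = ip1 x (s k *\<^sub>R u k)"
    by (simp add: ip_adj compact_ops_linear A R_compact adj_left)
qed

text \<open>Rank at most \<open>k\<close> forces \<open>L\<close> to kill some nonzero
  \<open>x\<close> in the span of the \<open>k + 1\<close> orthonormal vectors
  \<open>u 0, ..., u k\<close>, and \<open>A\<close> stretches each vector of this span by at least
  \<open>s k\<close>.\<close>

lemma s_le_norm_diff:
  assumes L: "L \<in> compact_ops s1 s2" "op_rank s2 L \<le> enat k"
  shows "s k \<le> norm (A - L)"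
proof (cases "s k = 0")
  case False
  \<comment> \<open>Makes all \<open>u i\<close> and \<open>v i\<close> with
    \<open>i \<le> k\<close> unit vectors.\<close>
  have nz: "R i \<noteq> 0" if "i \<le> k" for i
    using s_antimono[OF that] False by auto
  note linL = compact_ops_linear[OF L(1)] and linA = compact_ops_linear[OF A]
  obtain c where c: "\<exists>i\<in>{..k}. c i \<noteq> 0" "L (\<Sum>i\<in>{..k}. s1 (c i) (u i)) = 0"
    using op_rank_kernel[OF linL L(2), of "{..k}" u] by auto
  define x where "x = (\<Sum>i\<le>k. s1 (c i) (u i))"
  have "(norm x)\<^sup>2 = (\<Sum>i\<le>k. (norm (s1 (c i) (u i)))\<^sup>2)"
    unfolding x_def
    by (intro H1.norm_sum_orthogonal_sq) (simp_all add: H1.ip_scale_left H1.ip_scale_right_eq_0 u_orthogonal)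
  then have nx: "(norm x)\<^sup>2 = (\<Sum>i\<le>k. (norm (c i))\<^sup>2)"
    by (simp add: H1.norm_scale norm_sel R_compact nz)
  then have "x \<noteq> 0"
    using c(1) by (auto simp: sum_nonneg_eq_0_iff)
  have "A x = (\<Sum>i\<le>k. s2 (c i) (s i *\<^sub>R v i))"
    by (simp add: x_def blinfun.sum_right linear_opD[OF linA] A_u)
  then have "(norm (A x))\<^sup>2 = (\<Sum>i\<le>k. (norm (s2 (c i) (s i *\<^sub>R v i)))\<^sup>2)"
    by (simp only:, intro H2.norm_sum_orthogonal_sq)
       (simp_all add: H2.ip_scale_left H2.ip_scale_right_eq_0 H2.ip_scaleR_left H2.ip_scaleR_right v_orthogonal)
  also have "\<dots> = (\<Sum>i\<le>k. (norm (c i))\<^sup>2 * (s i)\<^sup>2)"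
    by (simp add: H2.norm_scale norm_left R_compact nz power_mult_distrib)
  also have "\<dots> \<ge> (\<Sum>i\<le>k. (norm (c i))\<^sup>2 * (s k)\<^sup>2)"
    by (intro sum_mono mult_left_mono power_mono s_antimono) auto
  finally have "(s k * norm x)\<^sup>2 \<le> (norm (A x))\<^sup>2"
    by (simp add: power_mult_distrib nx mult.commute flip: sum_distrib_right)
  then have "s k * norm x \<le> norm (A x)"
    by (rule power2_le_imp_le) simp
  also have "A x = (A - L) x"
    using c(2) by (simp add: blinfun.diff_left x_def)
  also have "norm ((A - L) x) \<le> norm (A - L) * norm x"
    by (rule norm_blinfun)
  finally show ?thesis
    using \<open>x \<noteq> 0\<close> by simp
qed simp

text \<open>\<open>trunc k\<close> is admissible in the infimum and has error \<open>s k\<close>; no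
  admissible operator does better.\<close>

lemma sing_val_eq: "sing_val s1 s2 (Suc k) A = s k"
proof (rule antisym)
  show "sing_val s1 s2 (Suc k) A \<le> s k"
    using sing_val_le[OF trunc_compact[of k] trunc_rank[of k], of A] by (simp add: A_minus_trunc)
qed (rule sing_val_greatest, rule s_le_norm_diff)

text \<open>A vanishing remainder would give \<open>A = trunc k\<close>, of rank at most
  \<open>k\<close>. The rank condition for orthonormality is used in this form.\<close>

lemma R_nonzero:
  assumes "enat (Suc k) \<le> op_rank s2 A"
  shows "R k \<noteq> 0"
proof
  assume "R k = 0"
  then have "A = trunc k"
    using A_minus_trunc[of k] by simp
  then have "enat (Suc k) \<le> enat k"
    using assms trunc_rank[of k] order_trans by metis
  then show False by simp
qed

lemma hs_norm_R_le:
  assumes "L \<in> compact_ops s1 s2" "op_rank s2 L \<le> enat n"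
  shows "hs_norm s1 s2 (R n) \<le> hs_norm s1 s2 (A - L)"
proof (rule hs_norm_mono)
  fix i
  \<comment> \<open>Deflating \<open>R n\<close> continues the deflation of \<open>A\<close>, so its
    singular values are those of \<open>A\<close> shifted by \<open>n\<close>.\<close>
  interpret Rn: compact_operator s1 ip1 s2 ip2 sel "R n"
    by unfold_locales (rule R_compact)
  have "sing_val s1 s2 (Suc i) (R n) = sing_val s1 s2 (Suc (n + i)) A"
    by (simp add: Rn.sing_val_eq sing_val_eq R_add)
  then show "sing_val s1 s2 (Suc i) (R n) \<le> sing_val s1 s2 (Suc i) (A - L)"
    using sing_val_diff_ge[OF assms] by simp
qed

text \<open>\<open>U\<close> and \<open>V\<close> are prescribed on \<open>{1..n}\<close> only, so
  restricted functions qualify.\<close>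

lemma truncated_svd:
  assumes U: "\<And>k. k < n \<Longrightarrow> U (Suc k) = u k" and V: "\<And>k. k < n \<Longrightarrow> V (Suc k) = v k"
  shows "truncated_svd s1 ip1 s2 ip2 n A U V"
proof -
  have all: "(\<forall>i\<in>{1..n}. P i) \<longleftrightarrow> (\<forall>k<n. P (Suc k))" for P
    unfolding image_Suc_lessThan[symmetric] by auto
  have "truncation s1 ip1 s2 n A U V = trunc n"
    by (simp add: truncation_def trunc_def sum.atLeast1_atMost_eq sing_val_eq U V)
  then have diff: "A - truncation s1 ip1 s2 n A U V = R n"
    by (simp add: A_minus_trunc)
  have norm: "s n = Inf {norm (A - L) |L. L \<in> compact_ops s1 s2 \<and> op_rank s2 L \<le> enat n}"
    using sing_val_eq[of n] by (simp add: sing_val_def)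
  have "hs_norm s1 s2 (R n) = Inf {hs_norm s1 s2 (A - L) |L. L \<in> compact_ops s1 s2 \<and> op_rank s2 L \<le> enat n}"
    (is "_ = Inf ?S")
  proof (rule antisym)
    show "hs_norm s1 s2 (R n) \<le> Inf ?S"
      by (rule Inf_greatest) (use hs_norm_R_le in auto)
    have "hs_norm s1 s2 (A - trunc n) \<in> ?S"
      using trunc_compact trunc_rank by blast
    then show "Inf ?S \<le> hs_norm s1 s2 (R n)"
      unfolding A_minus_trunc by (rule Inf_lower)
  qed
  moreover have "ip1 (u i) (u j) = (if i = j then 1 else 0) \<and> ip2 (v i) (v j) = (if i = j then 1 else 0)"
    if "enat (Suc i) \<le> op_rank s2 A" for i j
    using R_nonzero[OF that] R_compact[of i]
    by (cases "i = j") (simp_all add: u_orthogonal v_orthogonal H1.ip_unit H2.ip_unit norm_sel norm_left)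
  ultimately show ?thesis
    unfolding truncated_svd_def diff all
    by (simp add: U V norm sing_val_eq A_u adj_A_v flip: adj_apply[OF compact_ops_linear[OF A]])
qed

end

section \<open>Measurability\<close>

text \<open>
  The space of operators is not second countable, so a measurable family of operators is handled
  through its values at fixed vectors only.
\<close>

lemma measurable_blinfun_apply_pointwise:
  fixes T :: "'w \<Rightarrow> ('a::{real_normed_vector,second_countable_topology} \<Rightarrow>\<^sub>L 'b::real_normed_vector)"
  assumes T: "\<And>x. (\<lambda>\<omega>. T \<omega> x) \<in> borel_measurable M" and f: "f \<in> borel_measurable M"
  shows "(\<lambda>\<omega>. T \<omega> (f \<omega>)) \<in> borel_measurable M"
proof -
  \<comment> \<open>A simple function inserts only finitely many vectors into \<open>T\<close>;
    continuity of each \<open>T \<omega>\<close> handles the limit.\<close>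
  obtain F where F: "\<And>i. simple_function M (F i)" "\<And>\<omega>. \<omega> \<in> space M \<Longrightarrow> (\<lambda>i. F i \<omega>) \<longlonglongrightarrow> f \<omega>"
    using borel_measurable_implies_sequence_metric[OF f] by blast
  show ?thesis
  proof (rule borel_measurable_LIMSEQ_metric)
    fix i
    have "F i \<in> measurable M (count_space (F i ` space M))"
      using F(1)[of i] measurable_count_space_eq_countable[of "F i ` space M" "F i" M]
      by (auto simp: simple_function_def countable_finite)
    then show "(\<lambda>\<omega>. T \<omega> (F i \<omega>)) \<in> borel_measurable M"
      by (rule measurable_compose_countable'[where f = "\<lambda>x \<omega>. T \<omega> x", OF T])
         (use F(1)[of i] in \<open>simp add: simple_function_def countable_finite\<close>)
  next
    fix \<omega> assume "\<omega> \<in> space M"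
    then show "(\<lambda>i. T \<omega> (F i \<omega>)) \<longlonglongrightarrow> T \<omega> (f \<omega>)"
      by (intro tendsto_intros F)
  qed
qed

text \<open>Sublevel sets of the norm are countable intersections of conditions at the dense
  sequence.\<close>

lemma measurable_norm_blinfun_pointwise:
  fixes T :: "'w \<Rightarrow> ('a::{real_normed_vector,second_countable_topology} \<Rightarrow>\<^sub>L
    'b::{real_normed_vector,second_countable_topology})"
  assumes [measurable]: "\<And>x. (\<lambda>\<omega>. T \<omega> x) \<in> borel_measurable M"
  shows "(\<lambda>\<omega>. norm (T \<omega>)) \<in> borel_measurable M"
proof (rule borel_measurableI_le)
  fix r :: real
  show "{\<omega> \<in> space M. norm (T \<omega>) \<le> r} \<in> sets M"
  proof (cases "0 \<le> r")
    case True
    have "{\<omega> \<in> space M. \<forall>j. norm (T \<omega> (dense_seq j)) \<le> r * norm (dense_seq j :: 'a)} \<in> sets M"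
      by measurable
    then show ?thesis
      by (simp only: norm_blinfun_le_dense_iff[OF True])
  next
    case False
    then have "\<not> norm (T \<omega>) \<le> r" for \<omega>
      using norm_ge_zero[of "T \<omega>"] by linarith
    then show ?thesis by simp
  qed
qed

lemma measurable_sgn:
  fixes f :: "'w \<Rightarrow> 'a::{real_normed_vector,second_countable_topology}"
  assumes [measurable]: "f \<in> borel_measurable M"
  shows "(\<lambda>\<omega>. sgn (f \<omega>)) \<in> borel_measurable M"
  by (simp add: sgn_div_norm)

text \<open>\<open>frames_topology\<close> lives on restricted functions, so the map is factored
  through the full product \<open>G\<close>, followed by the continuous restriction
  \<open>g\<close>.\<close>

lemma measurable_borel_of_frames:
  fixes u :: "nat \<Rightarrow> 'w \<Rightarrow> 'a::second_countable_topology"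
    and v :: "nat \<Rightarrow> 'w \<Rightarrow> 'b::second_countable_topology"
  assumes [measurable]: "\<And>i. u i \<in> borel_measurable M" "\<And>i. v i \<in> borel_measurable M"
  shows "(\<lambda>\<omega>. (restrict (\<lambda>i. u i \<omega>) {1..n}, restrict (\<lambda>i. v i \<omega>) {1..n}))
    \<in> measurable M (borel_of (frames_topology n))"
proof -
  define G where "G \<omega> = ((\<lambda>i. u i \<omega>), (\<lambda>i. v i \<omega>))" for \<omega>
  define g :: "(nat \<Rightarrow> 'a) \<times> (nat \<Rightarrow> 'b) \<Rightarrow> (nat \<Rightarrow> 'a) \<times> (nat \<Rightarrow> 'b)"
    where "g p = (restrict (fst p) {1..n}, restrict (snd p) {1..n})" for p
  have "(\<lambda>\<omega>. (\<lambda>i. u i \<omega>)) \<in> borel_measurable M" "(\<lambda>\<omega>. (\<lambda>i. v i \<omega>)) \<in> borel_measurable M"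
    by (intro measurable_coordinatewise_then_product; simp)+
  then have G: "G \<in> borel_measurable M"
    unfolding G_def by (rule borel_measurable_Pair)
  have "continuous_on UNIV (\<lambda>p :: (nat \<Rightarrow> 'a) \<times> (nat \<Rightarrow> 'b). fst p i)"
    and "continuous_on UNIV (\<lambda>p :: (nat \<Rightarrow> 'a) \<times> (nat \<Rightarrow> 'b). snd p i)" for i
    by (rule continuous_on_compose2[OF continuous_on_product_coordinates continuous_on_fst[OF continuous_on_id]]
          continuous_on_compose2[OF continuous_on_product_coordinates continuous_on_snd[OF continuous_on_id]];
        rule subset_UNIV)+
  then have g: "continuous_map euclidean (frames_topology n) g"
    unfolding frames_topology_def g_def
    by (intro continuous_map_pairedI)
       (auto simp: continuous_map_componentwise continuous_map_iff_continuous2)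
  have "(\<lambda>\<omega>. g (G \<omega>)) \<in> measurable M (borel_of (frames_topology n))"
    unfolding borel_of_def
  proof (rule measurable_measure_of)
    show "{U. openin (frames_topology n) U} \<subseteq> Pow (topspace (frames_topology n))"
      by (auto dest: openin_subset)
    show "(\<lambda>\<omega>. g (G \<omega>)) \<in> space M \<rightarrow> topspace (frames_topology n)"
      using continuous_map_image_subset_topspace[OF g] by auto
    fix U :: "((nat \<Rightarrow> 'a) \<times> (nat \<Rightarrow> 'b)) set"
    assume "U \<in> {U. openin (frames_topology n) U}"
    then have "openin euclidean {p \<in> topspace euclidean. g p \<in> U}"
      using g by (intro openin_continuous_map_preimage) auto
    then have "open {p. g p \<in> U}" by simp
    then have "G -` {p. g p \<in> U} \<inter> space M \<in> sets M"
      by (intro measurable_sets[OF G]) simp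
    then show "(\<lambda>\<omega>. g (G \<omega>)) -` U \<inter> space M \<in> sets M"
      by (simp add: vimage_def)
  qed
  then show ?thesis
    by (simp add: g_def G_def)
qed

section \<open>Measurable families of compact operators\<close>

context hilbert_pair
begin

text \<open>Pointwise measurability of the adjoints is included because the power step applies
  them.\<close>

definition meas_family :: "'w measure \<Rightarrow> ('w \<Rightarrow> ('a \<Rightarrow>\<^sub>L 'b)) \<Rightarrow> bool"
  where "meas_family M T \<longleftrightarrow> (\<forall>\<omega>\<in>space M. T \<omega> \<in> compact_ops s1 s2) \<and>
    (\<forall>x. (\<lambda>\<omega>. T \<omega> x) \<in> borel_measurable M) \<and> (\<forall>y. (\<lambda>\<omega>. adj (T \<omega>) y) \<in> borel_measurable M)"

lemma meas_familyD:
  assumes "meas_family M T"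
  shows "\<omega> \<in> space M \<Longrightarrow> T \<omega> \<in> compact_ops s1 s2"
    and "f \<in> borel_measurable M \<Longrightarrow> (\<lambda>\<omega>. T \<omega> (f \<omega>)) \<in> borel_measurable M"
    and "g \<in> borel_measurable M \<Longrightarrow> (\<lambda>\<omega>. adj (T \<omega>) (g \<omega>)) \<in> borel_measurable M"
    and "(\<lambda>\<omega>. norm (T \<omega>)) \<in> borel_measurable M"
proof -
  have T: "(\<lambda>\<omega>. T \<omega> x) \<in> borel_measurable M" and adj: "(\<lambda>\<omega>. adj (T \<omega>) y) \<in> borel_measurable M" for x y
    using assms by (simp_all add: meas_family_def)
  show "f \<in> borel_measurable M \<Longrightarrow> (\<lambda>\<omega>. T \<omega> (f \<omega>)) \<in> borel_measurable M"
    by (rule measurable_blinfun_apply_pointwise[OF T])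
  show "g \<in> borel_measurable M \<Longrightarrow> (\<lambda>\<omega>. adj (T \<omega>) (g \<omega>)) \<in> borel_measurable M"
    by (rule measurable_blinfun_apply_pointwise[OF adj])
  show "(\<lambda>\<omega>. norm (T \<omega>)) \<in> borel_measurable M"
    by (rule measurable_norm_blinfun_pointwise[OF T])
qed (use assms in \<open>simp add: meas_family_def\<close>)

text \<open>Evaluation and, by the norm bound on adjoints, adjoint evaluation are continuous in the
  operator norm.\<close>

lemma meas_family_id: "meas_family (restrict_space borel (compact_ops s1 s2)) (\<lambda>A. A)"
proof -
  have "(norm y)-lipschitz_on (compact_ops s1 s2) (\<lambda>A. adj A y)" for y
  proof (rule lipschitz_onI)
    fix A B assume "A \<in> compact_ops s1 s2" "B \<in> compact_ops s1 s2"
    then have lin: "linear_op A" "linear_op B" by (simp_all add: compact_ops_linear)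
    then show "dist (adj A y) (adj B y) \<le> norm y * dist A B"
      using norm_adj_apply_le[OF linear_op_diff[OF lin], of y]
      by (simp add: dist_norm adj_diff blinfun.diff_left mult.commute)
  qed simp
  then have "continuous_on (compact_ops s1 s2) (\<lambda>A. adj A y)" for y
    by (rule lipschitz_on_continuous_on)
  then show ?thesis
    unfolding meas_family_def
    by (simp add: space_restrict_space borel_measurable_continuous_on_restrict blinfun.continuous_on)
qed

lemma measurable_pow_lim:
  assumes T: "meas_family M T"
  shows "(\<lambda>\<omega>. pow_lim (T \<omega>) x) \<in> borel_measurable M"
proof -
  have "(\<lambda>\<omega>. (pow_step (T \<omega>) ^^ m) x) \<in> borel_measurable M" for m
  proof (induction m)
    case (Suc m)
    note [measurable] = Suc meas_familyD(4)[OF T]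
      meas_familyD(3)[OF T meas_familyD(2)[OF T Suc]]
    show ?case
      by (simp add: pow_step_def[of _ "(pow_step _ ^^ m) x"])
  qed simp
  then show ?thesis
    unfolding pow_lim_def by (rule borel_measurable_lim_metric)
qed

text \<open>The least index is a measurable function with countably many values, so inserting it
  preserves measurability.\<close>

lemma measurable_top_vec:
  assumes T: "meas_family M T"
  shows "(\<lambda>\<omega>. top_vec (T \<omega>)) \<in> borel_measurable M"
proof -
  note [measurable] = measurable_pow_lim[OF T]
  have "(\<lambda>\<omega>. LEAST j. pow_lim (T \<omega>) (dense_seq j) \<noteq> 0) \<in> measurable M (count_space UNIV)"
    by measurable
  then show ?thesis
    unfolding top_vec_def
    using measurable_compose_countable[where f = "\<lambda>j \<omega>. pow_lim (T \<omega>) (dense_seq j)", OF measurable_pow_lim[OF T]]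
    by (intro measurable_sgn) simp
qed

lemma measurable_rank_one_apply:
  assumes "f \<in> borel_measurable M" "g \<in> borel_measurable M"
  shows "(\<lambda>\<omega>. s2 (ip1 x (f \<omega>)) (g \<omega>)) \<in> borel_measurable M"
  using assms
  by (rule borel_measurable_continuous_Pair)
     (intro bounded_bilinear.continuous_on[OF H2.bounded_bilinear_scale]
       bounded_bilinear.continuous_on[OF H1.bounded_bilinear_ip] continuous_intros)

end

context top_selector
begin

lemma measurable_left:
  assumes T: "meas_family M T" and sel: "(\<lambda>\<omega>. sel (T \<omega>)) \<in> borel_measurable M"
  shows "(\<lambda>\<omega>. left (T \<omega>)) \<in> borel_measurable M"
  using meas_familyD(2)[OF T sel] meas_familyD(4)[OF T] unfolding left_def by measurable

lemma meas_family_deflate: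
  assumes T: "meas_family M T" and sel: "(\<lambda>\<omega>. sel (T \<omega>)) \<in> borel_measurable M"
  shows "meas_family M (\<lambda>\<omega>. deflate (T \<omega>))"
proof -
  interpret swap: hilbert_pair s2 ip2 s1 ip1 ..
  note left = measurable_left[OF assms]
  note [measurable] = meas_familyD(4)[OF T]
    meas_familyD(2)[OF T measurable_const] meas_familyD(3)[OF T measurable_const]
    measurable_rank_one_apply[OF sel left] swap.measurable_rank_one_apply[OF left sel]
  \<comment> \<open>The formula for the adjoint is available at compact operators, that is, on the
    space of \<open>M\<close>.\<close>
  have "(\<lambda>\<omega>. adj (deflate (T \<omega>)) y) \<in> borel_measurable M \<longleftrightarrow>
      (\<lambda>\<omega>. adj (T \<omega>) y - norm (T \<omega>) *\<^sub>R s1 (ip2 y (left (T \<omega>))) (sel (T \<omega>))) \<in> borel_measurable M" for y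
    by (intro measurable_cong adj_deflate_apply meas_familyD(1)[OF T])
  then show ?thesis
    unfolding meas_family_def
    by (simp add: deflate_apply compact_ops_deflate meas_familyD(1)[OF T])
qed

definition svd :: "nat \<Rightarrow> ('b \<Rightarrow>\<^sub>L 'c) \<Rightarrow> (nat \<Rightarrow> 'b) \<times> (nat \<Rightarrow> 'c)"
  where "svd n A = (restrict (\<lambda>i. sel (resid A (i - 1))) {1..n},
                    restrict (\<lambda>i. left (resid A (i - 1))) {1..n})"

lemma truncated_svd_svd:
  assumes "A \<in> compact_ops s1 s2"
  shows "truncated_svd s1 ip1 s2 ip2 n A (fst (svd n A)) (snd (svd n A))"
proof -
  interpret compact_operator s1 ip1 s2 ip2 sel A
    by unfold_locales fact
  show ?thesis
    by (rule truncated_svd) (simp_all add: svd_def)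
qed

text \<open>The hypothesis speaks of families because the selector is applied to every remainder
  \<open>\<lambda>A. resid A k\<close>.\<close>

lemma measurable_svd:
  assumes sel: "\<And>T. meas_family (restrict_space borel (compact_ops s1 s2)) T \<Longrightarrow>
      (\<lambda>A. sel (T A)) \<in> borel_measurable (restrict_space borel (compact_ops s1 s2))"
  shows "svd n \<in> measurable (restrict_space borel (compact_ops s1 s2)) (borel_of (frames_topology n))"
proof -
  let ?M = "restrict_space borel (compact_ops s1 s2)"
  have R: "meas_family ?M (\<lambda>A. resid A k)" for k
  proof (induction k)
    case 0
    show ?case using meas_family_id by (simp add: resid_def)
  next
    case (Suc k)
    then show ?case
      using meas_family_deflate[OF Suc sel[OF Suc]] by (simp add: resid_def)
  qed
  show ?thesis
    unfolding svd_def[abs_def]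
    by (intro measurable_borel_of_frames sel R measurable_left)
qed

end

section \<open>Self-adjoint operators\<close>

sublocale hilbert_pair \<subseteq> top: top_selector s1 ip1 s2 ip2 top_vec
  by unfold_locales (simp_all add: adj_top_vec compact_ops_linear norm_top_vec top_vec_0)

locale hilbert_endo = hilbert_pair s1 ip1 s1 ip1
  for s1 :: "'k::real_or_complex \<Rightarrow> 'a::{banach,second_countable_topology} \<Rightarrow> 'a" and ip1
begin

text \<open>
  If \<open>A\<close> is self-adjoint, \<open>u\<close> a top vector and \<open>s = \<parallel>A\<parallel>\<close>, then \<open>A\<^sup>2 u = s\<^sup>2 u\<close>, so \<open>w = A u + s u\<close>
  satisfies \<open>A w = s w\<close>; and if \<open>w = 0\<close> then \<open>A u = - s u\<close>.
\<close>

definition eigen_vec :: "('a \<Rightarrow>\<^sub>L 'a) \<Rightarrow> 'a"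
  where "eigen_vec A = (let u = top_vec A; w = A u + norm A *\<^sub>R u
    in if w \<noteq> 0 \<and> A w = norm A *\<^sub>R w then sgn w else u)"

lemma eigen_vec_cases:
  obtains (top) "eigen_vec A = top_vec A"
  | (sgn) w where "eigen_vec A = sgn w" "w \<noteq> 0" "A w = norm A *\<^sub>R w"
  unfolding eigen_vec_def Let_def by metis

text \<open>This holds for every compact operator: the definition tests whether \<open>w\<close> is
  an eigenvector for \<open>norm A\<close>. If so, the norm is attained at \<open>w\<close> and
  \<open>norm_attained_imp_adj\<close> applies; otherwise the top vector is kept.\<close>

sublocale eigen: top_selector s1 ip1 s1 ip1 eigen_vec
proof
  fix A assume A: "A \<in> compact_ops s1 s1"
  show "adj A (A (eigen_vec A)) = (norm A)\<^sup>2 *\<^sub>R eigen_vec A"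
  proof (cases rule: eigen_vec_cases[of A])
    case top
    then show ?thesis by (simp add: adj_top_vec compact_ops_linear A)
  next
    case (sgn w)
    then have "norm (A w) = norm A * norm w" by simp
    from norm_attained_imp_adj[OF compact_ops_linear[OF A] this] show ?thesis
      by (simp add: sgn(1) sgn_div_norm blinfun.scaleR_right mult.commute)
  qed
  show "norm (eigen_vec A) = 1" if "A \<noteq> 0"
    using norm_top_vec[OF A that] by (cases rule: eigen_vec_cases[of A]) (auto simp: norm_sgn)
next
  show "eigen_vec 0 = 0"
    by (simp add: eigen_vec_def top_vec_0)
qed

lemma measurable_eigen_vec:
  assumes T: "meas_family M T"
  shows "(\<lambda>\<omega>. eigen_vec (T \<omega>)) \<in> borel_measurable M"
proof -
  note u = measurable_top_vec[OF T]
  define w where "w \<omega> = T \<omega> (top_vec (T \<omega>)) + norm (T \<omega>) *\<^sub>R top_vec (T \<omega>)" for \<omega>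
  note [measurable] = u meas_familyD(2)[OF T u] meas_familyD(4)[OF T]
  have w [measurable]: "w \<in> borel_measurable M"
    unfolding w_def by measurable
  note [measurable] = meas_familyD(2)[OF T w] measurable_sgn[OF w]
  have "(\<lambda>\<omega>. if w \<omega> \<noteq> 0 \<and> T \<omega> (w \<omega>) = norm (T \<omega>) *\<^sub>R w \<omega> then sgn (w \<omega>) else top_vec (T \<omega>))
      \<in> borel_measurable M"
    by measurable
  then show ?thesis
    unfolding eigen_vec_def Let_def w_def .
qed

text \<open>In both branches the chosen vector is an eigenvector of \<open>A\<close>, for
  \<open>norm A\<close> or for \<open>- norm A\<close>.\<close>

lemma self_adjoint_left:
  assumes A: "A \<in> compact_ops s1 s1" and self: "adj A = A"
  shows "eigen.left A = eigen_vec A \<or> eigen.left A = - eigen_vec A"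
proof (cases "A = 0")
  case True
  then show ?thesis by (simp add: eigen.left_0 eigen.sel_0)
next
  case False
  define w where "w = A (top_vec A) + norm A *\<^sub>R top_vec A"
  have "A (A (top_vec A)) = (norm A)\<^sup>2 *\<^sub>R top_vec A"
    using adj_top_vec[OF compact_ops_linear[OF A]] self by simp
  then have Aw: "A w = norm A *\<^sub>R w"
    by (simp add: w_def blinfun.add_right blinfun.scaleR_right scaleR_add_right power2_eq_square)
  show ?thesis
  proof (cases "w = 0")
    case True
    then have "A (top_vec A) = - (norm A *\<^sub>R top_vec A)"
      by (simp add: w_def eq_neg_iff_add_eq_0)
    moreover have "eigen_vec A = top_vec A"
      using True by (simp add: eigen_vec_def w_def)
    ultimately show ?thesis
      using False by (simp add: eigen.left_def)
  next
    case w: False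
    then have "eigen_vec A = sgn w"
      using Aw by (simp add: eigen_vec_def w_def Let_def)
    then show ?thesis
      using False Aw by (simp add: eigen.left_def sgn_div_norm blinfun.scaleR_right)
  qed
qed

text \<open>With left vector equal to plus or minus the right one, the subtracted rank-one term is
  self-adjoint. Hence \<open>self_adjoint_left\<close> applies to every remainder.\<close>

lemma adj_deflate_self_adjoint:
  assumes A: "A \<in> compact_ops s1 s1" and self: "adj A = A"
  shows "adj (eigen.deflate A) = eigen.deflate A"
proof (rule blinfun_eqI)
  fix x
  have "s1 (ip1 x (- u)) u = s1 (ip1 x u) (- u)" for u
    using H1.ip_scaleR_right[of x "-1" u] by simp
  then show "adj (eigen.deflate A) x = eigen.deflate A x"
    using self_adjoint_left[OF assms]
    by (auto simp: eigen.adj_deflate_apply[OF A] eigen.deflate_apply self)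
qed

text \<open>A minus sign would make \<open>u\<close> a unit eigenvector for the negative number
  \<open>- cpt.s k\<close>, which positivity of \<open>A\<close> excludes.\<close>

lemma svd_self_adjoint:
  assumes A: "A \<in> compact_ops s1 s1" and self: "self_adjoint_op ip1 A"
    and i: "i \<in> {1..n}" "sing_val s1 s1 i A > 0"
  defines "u \<equiv> fst (eigen.svd n A) i" and "v \<equiv> snd (eigen.svd n A) i"
  shows "u = v \<or> u = - v" and "positive_op ip1 A \<Longrightarrow> u = v"
proof -
  interpret cpt: compact_operator s1 ip1 s1 ip1 eigen_vec A
    by unfold_locales fact
  have adj_A: "adj A = A"
    using self adj_apply[OF compact_ops_linear[OF A]] blinfun_apply_inject
    unfolding self_adjoint_op_def by metis
  have adj_R: "adj (cpt.R k) = cpt.R k" for k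
    by (induction k)
       (simp_all add: cpt.R_0 cpt.R_Suc adj_A adj_deflate_self_adjoint cpt.R_compact)
  obtain k where k: "i = Suc k"
    using i(1) by (cases i) auto
  have u: "u = cpt.u k" and v: "v = cpt.v k"
    using i(1) by (simp_all add: u_def v_def eigen.svd_def k)
  have "cpt.s k > 0"
    using i(2) by (simp add: k cpt.sing_val_eq)
  then have "norm u = 1"
    unfolding u by (intro eigen.norm_sel cpt.R_compact) auto
  show pm: "u = v \<or> u = - v"
    unfolding u v using self_adjoint_left[OF cpt.R_compact[of k] adj_R[of k]] by (metis minus_minus)
  show "u = v" if "positive_op ip1 A"
  proof (rule ccontr)
    assume "u \<noteq> v"
    with pm have "v = - u" by auto
    moreover have "A u = cpt.s k *\<^sub>R v"
      unfolding u v by (rule cpt.A_u)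
    ultimately have "A u = (- cpt.s k) *\<^sub>R u" by simp
    then have "Re (to_complex (ip1 (A u) u)) = - cpt.s k"
      using \<open>norm u = 1\<close>
      by (simp only: H1.rip_scaleR_left H1.rip_self flip: H1.rip_def) simp
    moreover have "0 \<le> Re (to_complex (ip1 (A u) u))"
      using that by (simp add: positive_op_def)
    ultimately show False
      using \<open>cpt.s k > 0\<close> by simp
  qed
qed

end

text \<open>The eigenvector correction makes sense only when both spaces agree, so that case has a
  map of its own, which satisfies all claims at once.\<close>

theorem theorem4:
  fixes scale1 :: "'k::real_or_complex \<Rightarrow> 'a::{banach,second_countable_topology} \<Rightarrow> 'a"
    and ip1 :: "'a \<Rightarrow> 'a \<Rightarrow> 'k"
    and scale2 :: "'k \<Rightarrow> 'b::{banach,second_countable_topology} \<Rightarrow> 'b"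
    and ip2 :: "'b \<Rightarrow> 'b \<Rightarrow> 'k"
    and n :: nat
  assumes H1: "hilbert_space scale1 ip1"
    and H2: "hilbert_space scale2 ip2"
    and n: "n \<ge> 1"
  shows "(\<exists>F :: ('a \<Rightarrow>\<^sub>L 'b) \<Rightarrow> (nat \<Rightarrow> 'a) \<times> (nat \<Rightarrow> 'b).
            F \<in> measurable (restrict_space borel (compact_ops scale1 scale2))
                           (borel_of (frames_topology n)) \<and>
            (\<forall>A\<in>compact_ops scale1 scale2.
               truncated_svd scale1 ip1 scale2 ip2 n A (fst (F A)) (snd (F A)))) \<and>
         (\<exists>F :: ('a \<Rightarrow>\<^sub>L 'a) \<Rightarrow> (nat \<Rightarrow> 'a) \<times> (nat \<Rightarrow> 'a).
            F \<in> measurable (restrict_space borel (compact_ops scale1 scale1))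
                           (borel_of (frames_topology n)) \<and>
            (\<forall>A\<in>compact_ops scale1 scale1.
               truncated_svd scale1 ip1 scale1 ip1 n A (fst (F A)) (snd (F A)) \<and>
               (self_adjoint_op ip1 A \<longrightarrow>
                  (\<forall>i\<in>{1..n}. sing_val scale1 scale1 i A > 0 \<longrightarrow>
                     (fst (F A) i = snd (F A) i \<or> fst (F A) i = - snd (F A) i) \<and>
                     (positive_op ip1 A \<longrightarrow> fst (F A) i = snd (F A) i)))))"
proof (intro conjI exI ballI)
  interpret pair: hilbert_pair scale1 ip1 scale2 ip2
    by (intro hilbert_pair.intro H1 H2)
  show "pair.top.svd n \<in> measurable (restrict_space borel (compact_ops scale1 scale2))
      (borel_of (frames_topology n))"
    by (intro pair.top.measurable_svd pair.measurable_top_vec)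
  show "truncated_svd scale1 ip1 scale2 ip2 n A (fst (pair.top.svd n A)) (snd (pair.top.svd n A))"
    if "A \<in> compact_ops scale1 scale2" for A
    using that by (rule pair.top.truncated_svd_svd)
next
  interpret endo: hilbert_endo scale1 ip1
    by (intro hilbert_endo.intro hilbert_pair.intro H1)
  show "endo.eigen.svd n \<in> measurable (restrict_space borel (compact_ops scale1 scale1))
      (borel_of (frames_topology n))"
    by (intro endo.eigen.measurable_svd endo.measurable_eigen_vec)
  fix A assume A: "A \<in> compact_ops scale1 scale1"
  let ?u = "fst (endo.eigen.svd n A)" and ?v = "snd (endo.eigen.svd n A)"
  show "truncated_svd scale1 ip1 scale1 ip1 n A ?u ?v"
    using A by (rule endo.eigen.truncated_svd_svd)
  show "self_adjoint_op ip1 A \<longrightarrow> (\<forall>i\<in>{1..n}. sing_val scale1 scale1 i A > 0 \<longrightarrow>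
      (?u i = ?v i \<or> ?u i = - ?v i) \<and> (positive_op ip1 A \<longrightarrow> ?u i = ?v i))"
    using endo.svd_self_adjoint[OF A] by blast
qed

end
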